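(* Let $X=X_n$ be the number of correct guesses under the optimal strategy for an $n$-card deck riffle-shuffled once. As $n\to\infty$ through odd integers, $$E[X(X-1)]=\frac{n^2}{4}+\sqrt{\frac2\pi}\,n^{3/2}-\frac n4-\sqrt{\frac{2n}{\pi}}\left(\frac{11}{4}+\frac{5}{96n}+\frac{1753}{1152n^2}+\frac{13733}{2048n^3}+O(n^{-4})\right),$$ $$E[X(X-1)(X-2)]=\frac{n^3}{8}+\frac34\sqrt{\frac2\pi}\,n^{5/2}-\frac{65}{16}\sqrt{\frac2\pi}\,n^{3/2}-\frac{13n}{8}+\sqrt{\frac{2n}{\pi}}\left(\frac{763}{128}-\frac{2681}{1536n}-\frac{443239}{73728n^2}+O(n^{-3})\right).$$ As $n\to\infty$ through even integers, $$E[X(X-1)]=\frac{n^2}{4}+\sqrt{\frac2\pi}\,n^{3/2}-\frac n4-\sqrt{\frac{2n}{\pi}}\left(\frac{11}{4}+\frac{1}{96n}+\frac{1901}{1152n^2}+\frac{13917}{2048n^3}+O(n^{-4})\right),$$ $$E[X(X-1)(X-2)]=\frac{n^3}{8}+\frac34\sqrt{\frac2\pi}\,n^{5/2}-\frac{65}{16}\sqrt{\frac2\pi}\,n^{3/2}-\frac{13n}{8}+\sqrt{\frac{2n}{\pi}}\left(\frac{767}{128}-\frac{3085}{1536n}-\frac{413903}{73728n^2}+O(n^{-3})\right).$$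
   Context: Riffle shuffle (Gilbert–Shannon–Reeds model): a deck of $n$ cards labeled $1,\dots,n$ from top to bottom is cut so that the top pile consists of the top $t$ cards with probability $\binom{n}{t}/2^n$ ($0\le t\le n$); then the two piles are interleaved into a single deck, keeping the relative order inside each pile, all $\binom nt$ interleavings being equally likely. Thus each pair (cut position, interleaving) has probability $2^{-n}$. Game with complete feedback: after one riffle shuffle the player guesses the cards one at a time from the top; after each guess the identity of that card is revealed. The goal is to maximize the expected number of correct guesses. Optimal strategy for one shuffle: as long as the revealed cards are $1,2,\dots,j$ (with $j\ge 0$), guess $j+1$. At the first time the revealed card is some $m\neq j+1$, the remaining deck is known to be an interleaving of the two increasing sequences $\{j+1,\dots,m-1\}$ and $\{m+1,\dots,n\}$; from then on, always guess the first (smallest) remaining card of the longer of the two remaining sequences (in case of equal lengths, the one giving the lower card number). $X_n$ is the total number of correct guesses under this strategy for a deck of $n$ cards shuffled once. *)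

theory Defs
  imports "HOL-Probability.Probability" "HOL-Library.Landau_Symbols"
begin

text \<open>
  A deck is the list of its cards from top to bottom, with cards \<open>1, \<dots>, n\<close>.  Since the two piles
  have no card in common, the set \<^term>\<open>shuffles xs ys\<close> has exactly one element for each of the
  \<open>n choose t\<close> interleavings.
\<close>

definition riffle_shuffle :: "nat \<Rightarrow> nat list pmf" where
  "riffle_shuffle n =
     bind_pmf (binomial_pmf n (1/2))
       (\<lambda>t. pmf_of_set (shuffles [1..<Suc t] [Suc t..<Suc n]))"

text \<open>
  With complete feedback, a strategy maps the list of cards revealed so far (in order of
  revelation) to the next guess.
\<close>

definition correct_guesses :: "(nat list \<Rightarrow> nat) \<Rightarrow> nat list \<Rightarrow> nat" where
  "correct_guesses strategy deck =
     card {i. i < length deck \<and> strategy (take i deck) = deck ! i}"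

definition initial_run :: "nat list \<Rightarrow> nat" where
  "initial_run revealed = Max {j. j \<le> length revealed \<and> take j revealed = [1..<Suc j]}"

text \<open>
  After the initial run \<open>1, \<dots>, j\<close>, the first card \<open>m \<noteq> j + 1\<close> to be revealed is the top card of the
  bottom pile.  From then on \<open>as\<close> and \<open>bs\<close> are what remains of the two increasing sequences; they
  are both empty only when the whole deck has been revealed, so \<^term>\<open>hd []\<close> is never guessed
  while playing with a riffle-shuffled deck.  In case of a tie the lower card number is \<open>hd as\<close>.
\<close>

definition optimal_guess :: "nat \<Rightarrow> nat list \<Rightarrow> nat" where
  "optimal_guess n revealed =
     (let j = initial_run revealed in
      if j = length revealed then j + 1
      else
        let m = revealed ! j;
            as = filter (\<lambda>c. c \<notin> set revealed) [j + 1..<m];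
            bs = filter (\<lambda>c. c \<notin> set revealed) [m + 1..<n + 1]
        in if length as \<ge> length bs then hd as else hd bs)"

definition X :: "nat \<Rightarrow> nat list \<Rightarrow> real" where
  "X n deck = real (correct_guesses (optimal_guess n) deck)"

definition odd_at_top :: "nat filter" where
  "odd_at_top = inf at_top (principal {n. odd n})"

definition even_at_top :: "nat filter" where
  "even_at_top = inf at_top (principal {n. even n})"

end

theory Submission
  imports Defs "HOL-Real_Asymp.Real_Asymp"
begin

text \<open>
  Read the shuffled deck from the top and write \<open>True\<close> for a card of the top pile and \<open>False\<close> for a
  card of the bottom pile.  Each pair of a cut and an interleaving gives one word, and all
  \<open>2 ^ n\<close> words are equally likely.  The number of correct guesses depends on the word only: the
  letters \<open>True\<close> at its start are correct guesses, and after the first \<open>False\<close> (unless the deck is in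
  order) the player names the longer remaining pile.  This reduces the moments to averages over words
  (\<open>expectation_riffle\<close>).

  Read the part of the word after the first \<open>False\<close> from its end.  The difference of the two
  remaining piles is then a simple random walk \<open>S\<close> started at \<open>0\<close>, and a guess is correct
  precisely if the corresponding step leads away from \<open>0\<close>, or leads from \<open>-1\<close> to \<open>0\<close> (the tie
  rule).  After \<open>N\<close> steps the number of correct guesses is therefore \<open>(N + \<bar>S\<bar>) / 2\<close> plus the number of
  returns to \<open>0\<close> from \<open>-1\<close> (\<open>hits_eq\<close>).  One more step changes a factorial moment of this number
  by lower moments, and by moments restricted to the event that the walk is at \<open>0\<close> or \<open>-1\<close>.  The
  latter are polynomials in the length and in the probability
  \<open>c n = (n choose (n div 2)) / 2 ^ n\<close> of that event, by linear recursions in the time and the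
  position of the walk (\<open>G1_at_0\<close>, \<open>G2_step\<close>).  So the first three factorial moments of
  the hits have the exact form \<open>P n + c n * Q n\<close> with a polynomial \<open>P\<close> and one
  polynomial \<open>Q\<close> for each parity of \<open>n\<close>.

  Splitting off the first letter of the word gives
  \<open>M k (n + 1) = (M k n + k * M (k - 1) n + H k n) / 2\<close> for the factorial moments \<open>M k\<close> of the score
  and \<open>H k\<close> of the hits, up to an exponentially small term.  This recursion
  halves errors: if \<open>P n + c n * R n\<close> satisfies it up to a residual of order
  \<open>g\<close>, then its distance from \<open>M k\<close> is of order \<open>g\<close> as well (\<open>bigo_recursion_half\<close>).  For \<open>R\<close> one takes
  the truncated Laurent expansion that the recursion dictates, for each parity separately.

  Finally \<open>c n * sqrt (pi * n / 2)\<close> tends to \<open>1\<close> by Wallis' product, and \<open>c (n + 2) / c n\<close> is a rational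
  function of \<open>n\<close>.  Summing the logarithms of these ratios from \<open>n\<close> to infinity determines
  \<open>c n * sqrt (pi * n / 2)\<close> up to an error of order \<open>1 / n ^ 5\<close>; multiplying this expansion by \<open>R\<close>
  gives the coefficients of the theorem.
\<close>

section \<open>Averages over words\<close>

definition word_mean :: "nat \<Rightarrow> (bool list \<Rightarrow> real) \<Rightarrow> real" where
  "word_mean N f = (\<Sum>w | length w = N. f w) / 2 ^ N"

lemma finite_words [simp]: "finite {w :: bool list. length w = N}"
  using finite_lists_length_eq[of "UNIV :: bool set" N] by simp

lemma sum_words_Suc:
  "(\<Sum>w | length w = Suc N. f w) =
     (\<Sum>w | length w = N. f (True # w)) + (\<Sum>w | length w = N. f (False # w) :: 'a :: comm_monoid_add)"
proof -
  have "{w :: bool list. length w = Suc N} =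
      (#) True ` {w. length w = N} \<union> (#) False ` {w. length w = N}"
  proof (rule set_eqI)
    fix w :: "bool list"
    show "w \<in> {w. length w = Suc N} \<longleftrightarrow>
        w \<in> (#) True ` {w. length w = N} \<union> (#) False ` {w. length w = N}"
    proof (cases w)
      case (Cons b u)
      then show ?thesis by (cases b) auto
    qed auto
  qed
  then have "(\<Sum>w | length w = Suc N. f w) =
      sum f ((#) True ` {w. length w = N}) + sum f ((#) False ` {w. length w = N})"
    by (simp only:) (rule sum.union_disjoint, auto)
  then show ?thesis
    by (simp add: sum.reindex)
qed

lemma word_mean_0 [simp]: "word_mean 0 f = f []"
  by (simp add: word_mean_def)

lemma word_mean_Suc:
  "word_mean (Suc N) f = word_mean N (\<lambda>w. (f (True # w) + f (False # w)) / 2)"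
  by (simp add: word_mean_def sum_words_Suc sum.distrib flip: sum_divide_distrib)

lemma word_mean_add: "word_mean N (\<lambda>w. f w + g w) = word_mean N f + word_mean N g"
  by (simp add: word_mean_def sum.distrib add_divide_distrib)

lemma word_mean_cmult: "word_mean N (\<lambda>w. a * f w) = a * word_mean N f"
  by (simp add: word_mean_def flip: sum_distrib_left)

lemma word_mean_const [simp]: "word_mean N (\<lambda>w. a) = a"
  using card_lists_length_eq[of "UNIV :: bool set" N] by (simp add: word_mean_def)

lemma word_mean_cong:
  "(\<And>w. length w = N \<Longrightarrow> f w = g w) \<Longrightarrow> word_mean N f = word_mean N g"
  by (auto simp: word_mean_def intro!: sum.cong)

lemma word_mean_delta:
  assumes "length v = N" shows "word_mean N (\<lambda>w. if w = v then a else 0) = a / 2 ^ N"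
  using assms by (simp add: word_mean_def)

section \<open>The walk of remaining pile sizes\<close>

text \<open>
  The head of the list is the next card to be revealed, so recursion on lists runs backwards in time:
  \<open>excess\<close> performs one step of the walk per letter, and \<open>returns\<close> and \<open>hits\<close> judge the guess made when
  \<open>b # w\<close> is what remains.
\<close>

fun excess :: "bool list \<Rightarrow> int" where
  "excess [] = 0"
| "excess (b # w) = excess w + (if b then 1 else -1)"

fun returns :: "bool list \<Rightarrow> nat" where
  "returns [] = 0"
| "returns (b # w) = returns w + of_bool (b \<and> excess w = -1)"

fun hits :: "bool list \<Rightarrow> nat" where
  "hits [] = 0"
| "hits (b # w) = hits w + of_bool (b \<longleftrightarrow> excess (b # w) \<ge> 0)"

text \<open>
  Steps away from \<open>0\<close> outnumber steps towards \<open>0\<close> by \<open>\<bar>excess w\<bar>\<close>, and among the latter only those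
  from \<open>-1\<close> to \<open>0\<close> count.
\<close>

lemma hits_eq: "2 * int (hits w) = int (length w) + \<bar>excess w\<bar> + 2 * int (returns w)"
  by (induction w) auto

lemma hits_eq_real:
  "real (hits w) = (real (length w) + of_int \<bar>excess w\<bar>) / 2 + real (returns w)"
proof -
  have "real_of_int (2 * int (hits w)) = of_int (int (length w) + \<bar>excess w\<bar> + 2 * int (returns w))"
    by (simp only: hits_eq)
  then show ?thesis by (simp add: field_simps)
qed

lemma even_excess: "even (excess w + int (length w))"
  by (induction w) auto

lemma abs_excess_le: "\<bar>excess w\<bar> \<le> int (length w)"
  by (induction w) auto

definition local_mean :: "nat \<Rightarrow> int \<Rightarrow> (real \<Rightarrow> real) \<Rightarrow> real" where
  "local_mean N s g = word_mean N (\<lambda>w. of_bool (excess w = s) * g (real (returns w)))"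

lemma local_mean_0: "local_mean 0 s g = (if s = 0 then g 0 else 0)"
  by (simp add: local_mean_def)

lemma local_mean_Suc:
  "local_mean (Suc N) s g =
     (local_mean N (s - 1) (\<lambda>r. if s = 0 then g (r + 1) else g r) + local_mean N (s + 1) g) / 2"
proof -
  have "local_mean (Suc N) s g =
      word_mean N (\<lambda>w. 1/2 * (of_bool (excess w = s - 1) * (\<lambda>r. if s = 0 then g (r + 1) else g r) (real (returns w))
         + of_bool (excess w = s + 1) * g (real (returns w))))"
    unfolding local_mean_def word_mean_Suc
    by (intro word_mean_cong) (auto simp: algebra_simps)
  then show ?thesis
    unfolding local_mean_def word_mean_cmult word_mean_add by simp
qed

lemma local_mean_add: "local_mean N s (\<lambda>r. f r + g r) = local_mean N s f + local_mean N s g"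
  by (simp add: local_mean_def algebra_simps flip: word_mean_add)

lemma local_mean_cmult: "local_mean N s (\<lambda>r. a * g r) = a * local_mean N s g"
  by (simp add: local_mean_def algebra_simps flip: word_mean_cmult)

text \<open>
  Reflecting the walk after its last visit to \<open>0\<close> changes the sign of the endpoint and keeps the
  returns.
\<close>

lemma local_mean_minus: "local_mean N (- s) g = local_mean N s g"
proof (induction N arbitrary: s g)
  case (Suc N)
  show ?case
  proof (cases "s = 0")
    case False
    have "local_mean N (- s - 1) g = local_mean N (s + 1) g"
         "local_mean N (- s + 1) g = local_mean N (s - 1) g"
      using Suc.IH[of "s + 1" g] Suc.IH[of "s - 1" g] by simp_all
    then show ?thesis using False by (simp add: local_mean_Suc)
  qed auto
qed (simp add: local_mean_0)

lemma local_mean_eq_0: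
  assumes "int N < \<bar>s\<bar>" shows "local_mean N s g = 0"
proof -
  have "local_mean N s g = word_mean N (\<lambda>w. 0)"
    unfolding local_mean_def using assms abs_excess_le
    by (intro word_mean_cong) (auto simp: not_less[symmetric])
  then show ?thesis by simp
qed

text \<open>
  Every visit to \<open>0\<close> is equally likely to come from \<open>1\<close> and from \<open>-1\<close>, so that given the number \<open>Z\<close> of
  visits to \<open>0\<close> after the start the returns are a binomial variable with parameters \<open>Z\<close> and \<open>1/2\<close>.
  The three combinations below are thereby the restricted means of \<open>1\<close>, \<open>Z + 1\<close> and
  \<open>(Z + 2) choose 2\<close>.  As functions of time they have the generating functions
  \<open>L z ^ s / (1 - z\<^sup>2) powr ((k + 1) / 2)\<close> for \<open>k = 0, 1, 2\<close> and \<open>s \<ge> 0\<close>, with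
  \<open>L z = (1 - sqrt (1 - z\<^sup>2)) / z\<close>; this is why they obey simpler recursions than the moments
  of the returns.
\<close>

definition G0 :: "nat \<Rightarrow> int \<Rightarrow> real" where "G0 N s = local_mean N s (\<lambda>r. 1)"
definition G1 :: "nat \<Rightarrow> int \<Rightarrow> real" where "G1 N s = local_mean N s (\<lambda>r. 2 * r + 1)"
definition G2 :: "nat \<Rightarrow> int \<Rightarrow> real" where "G2 N s = local_mean N s (\<lambda>r. 2 * r ^ 2 + 2 * r + 1)"

lemmas G_defs = G0_def G1_def G2_def

lemma G_0 [simp]:
  "G0 0 s = of_bool (s = 0)" "G1 0 s = of_bool (s = 0)" "G2 0 s = of_bool (s = 0)"
  by (auto simp: G_defs local_mean_0)

lemma G_minus: "G0 N (- s) = G0 N s" "G1 N (- s) = G1 N s" "G2 N (- s) = G2 N s"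
  unfolding G_defs by (rule local_mean_minus)+

lemma G0_Suc: "G0 (Suc N) s = (G0 N (s - 1) + G0 N (s + 1)) / 2"
  by (simp add: G_defs local_mean_Suc)

lemma G1_Suc: "s \<noteq> 0 \<Longrightarrow> G1 (Suc N) s = (G1 N (s - 1) + G1 N (s + 1)) / 2"
  by (simp add: G_defs local_mean_Suc)

lemma G2_Suc: "s \<noteq> 0 \<Longrightarrow> G2 (Suc N) s = (G2 N (s - 1) + G2 N (s + 1)) / 2"
  by (simp add: G_defs local_mean_Suc)

lemma G0_Suc_0: "G0 (Suc N) 0 = G0 N 1"
  using G_minus(1)[of N 1] by (simp add: G0_Suc)

lemma G1_Suc_0: "G1 (Suc N) 0 = G1 N 1 + G0 (Suc N) 0"
proof -
  have "local_mean N (-1) (\<lambda>r. 2 * (r + 1) + 1) =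
      local_mean N (-1) (\<lambda>r. (2 * r + 1) + 2 * 1)"
    by (rule arg_cong[of _ _ "local_mean N (-1)"]) auto
  also have "\<dots> = G1 N (-1) + 2 * G0 N (-1)"
    unfolding G_defs local_mean_add local_mean_cmult ..
  finally show ?thesis
    using G_minus[of N 1] by (simp add: local_mean_Suc G1_def[of "Suc N"] G1_def[of N 1] G0_Suc_0)
qed

lemma G2_Suc_0: "G2 (Suc N) 0 = G2 N 1 + G1 (Suc N) 0"
proof -
  have "local_mean N (-1) (\<lambda>r. 2 * (r + 1) ^ 2 + 2 * (r + 1) + 1) =
      local_mean N (-1) (\<lambda>r. (2 * r ^ 2 + 2 * r + 1) + (2 * (2 * r + 1) + 2 * 1))"
    by (rule arg_cong[of _ _ "local_mean N (-1)"]) (auto simp: power2_eq_square algebra_simps)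
  also have "\<dots> = G2 N (-1) + (2 * G1 N (-1) + 2 * G0 N (-1))"
    unfolding G_defs local_mean_add[of _ _ "\<lambda>r. 2 * r ^ 2 + 2 * r + 1"]
      local_mean_add[of _ _ "\<lambda>r. 2 * (2 * r + 1)"] local_mean_cmult ..
  finally show ?thesis
    using G_minus[of N 1]
    by (simp add: local_mean_Suc G2_def[of "Suc N"] G2_def[of N 1] G0_Suc_0 G1_Suc_0)
qed

text \<open>
  In terms of generating functions this is \<open>1 - L\<^sup>2 = (1 + L\<^sup>2) * sqrt (1 - z\<^sup>2)\<close>.
\<close>

lemma G1_diff: "s \<ge> 0 \<Longrightarrow> G1 N s - G1 N (s + 2) = G0 N s + G0 N (s + 2)"
proof (induction N arbitrary: s)
  case (Suc N)
  show ?case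
  proof (cases "s = 0")
    case True
    then show ?thesis using Suc.IH[of 1] G1_Suc[of 2 N] G0_Suc[of N 2] G1_Suc_0[of N] G0_Suc_0[of N] by simp
  next
    case False
    then show ?thesis using Suc.IH[of "s - 1"] Suc.IH[of "s + 1"] Suc.prems G1_Suc[of s N] G1_Suc[of "s + 2" N]
      G0_Suc[of N s] G0_Suc[of N "s + 2"] by (simp add: algebra_simps add_divide_distrib)
  qed
qed auto

text \<open>
  The generating function is \<open>1 / (1 - z\<^sup>2)\<close>.  Equivalently, the numbers
  \<open>(2 * k choose k) / 4 ^ k\<close> convolve with themselves to the constant \<open>1\<close>.
\<close>

lemma G1_at_0: "G1 (2 * m) 0 = 1"
proof (induction m)
  case (Suc m)
  have "G1 (Suc (Suc (2 * m))) 0 = G1 (Suc (2 * m)) 1 + G0 (Suc (2 * m)) 1"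
    by (simp add: G1_Suc_0 G0_Suc_0)
  also have "\<dots> = (G1 (2 * m) 0 + G1 (2 * m) 2 + G0 (2 * m) 0 + G0 (2 * m) 2) / 2"
    by (simp add: G1_Suc G0_Suc add_divide_distrib)
  also have "\<dots> = G1 (2 * m) 0"
    using G1_diff[of 0 "2 * m"] by simp
  finally show ?case using Suc.IH by simp
qed simp

lemma local_mean_parity:
  assumes "odd (int N + s)" shows "local_mean N s g = 0"
proof -
  have "local_mean N s g = word_mean N (\<lambda>w. 0)"
    unfolding local_mean_def using assms even_excess
    by (intro word_mean_cong) (auto simp: add.commute)
  then show ?thesis by simp
qed

text \<open>
  The generating functions for \<open>k = 2\<close> and \<open>k = 0\<close> differ by the factor \<open>1 / (1 - z\<^sup>2)\<close>.
\<close>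

lemma G2_step: "s \<ge> 0 \<Longrightarrow> G2 (Suc (Suc N)) s = G2 N s + G0 (Suc (Suc N)) s"
proof (induction N arbitrary: s)
  case 0
  consider "s = 0" | "s = 1" | "s = 2" | "s > 2" using 0 by linarith
  then show ?case
    by cases (auto simp: G1_Suc G2_Suc G0_Suc G0_Suc_0 G1_Suc_0 G2_Suc_0)
next
  case (Suc N)
  show ?case
  proof (cases "s = 0")
    case True
    have "G1 (Suc (Suc (Suc N))) 0 = G1 (Suc N) 0"
    proof (cases "even (Suc N)")
      case True
      then obtain m where "Suc N = 2 * m" by blast
      then show ?thesis using G1_at_0[of m] G1_at_0[of "Suc m"] by simp
    next
      case False
      then show ?thesis by (simp add: G_defs local_mean_parity)
    qed
    then show ?thesis using Suc.IH[of 1] True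
      by (simp add: G2_Suc_0 G0_Suc_0[of "Suc (Suc N)"])
  next
    case False
    then show ?thesis using Suc.IH[of "s - 1"] Suc.IH[of "s + 1"] Suc.prems
      by (simp add: G2_Suc[of s] G0_Suc[of "Suc (Suc N)" s] flip: add_divide_distrib)
  qed
qed

text \<open>
  The probability that the walk is at \<open>0\<close> or at \<open>-1\<close> after \<open>n\<close> steps; the parity of \<open>n\<close> decides
  which of the two is possible.
\<close>

definition central :: "nat \<Rightarrow> real" where
  "central n = real (n choose (n div 2)) / 2 ^ n"

lemma G0_binomial: "G0 N (2 * int t - int N) = real (N choose t) / 2 ^ N"
proof (induction N arbitrary: t)
  case 0
  show ?case by (cases t) auto
next
  case (Suc N)
  show ?case
  proof (cases t)
    case 0
    have "G0 N (- 2 - int N) = 0" unfolding G_defs by (rule local_mean_eq_0) auto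
    then show ?thesis using Suc.IH[of 0] 0 by (simp add: G0_Suc)
  next
    case (Suc t')
    then show ?thesis using Suc.IH[of t'] Suc.IH[of t] by (simp add: G0_Suc algebra_simps add_divide_distrib)
  qed
qed

lemma central_even: "central (2 * m) = G0 (2 * m) 0"
  using G0_binomial[of "2 * m" m] by (simp add: central_def)

lemma central_odd: "central (Suc (2 * m)) = G0 (Suc (2 * m)) (-1)"
  using G0_binomial[of "Suc (2 * m)" m] by (simp add: central_def)

lemma central_0 [simp]: "central 0 = 1" by (simp add: central_def)

lemma central_Suc_odd: "odd n \<Longrightarrow> central (Suc n) = central n"
  using G0_Suc_0[of n] G_minus[of n 1] central_even[of "Suc n div 2"] central_odd[of "n div 2"]
  by simp

lemma central_Suc_even:
  assumes "even n" shows "central (Suc n) = central n * (real n + 1) / (real n + 2)"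
proof -
  obtain m where n: "n = 2 * m" using assms by blast
  have "Suc m * (Suc (2 * m) choose m) = Suc (2 * m) * (2 * m choose m)"
    using Suc_times_binomial[of m "2 * m"] binomial_symmetric[of m "Suc (2 * m)"] by simp
  then have "real (Suc m * (Suc (2 * m) choose m)) = real (Suc (2 * m) * (2 * m choose m))"
    by (simp only:)
  then have "(1 + real m) * real (Suc (2 * m) choose m) = (2 * real m + 1) * real (2 * m choose m)"
    by (simp add: algebra_simps)
  then have "real (Suc (2 * m) choose m) = real (2 * m choose m) * (2 * real m + 1) / (1 + real m)"
    by (simp add: field_simps del: binomial_Suc_Suc)
  then show ?thesis by (simp add: central_def n divide_simps del: binomial_Suc_Suc) (simp add: algebra_simps)
qed

lemma central_pos: "central n > 0"
  by (simp add: central_def)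

lemma G2_at_0: "G2 (2 * m) 0 = (2 * real m + 1) * central (2 * m)"
proof (induction m)
  case (Suc m)
  have "central (2 * Suc m) = central (2 * m) * (2 * real m + 1) / (2 * real m + 2)"
    using central_Suc_odd[of "Suc (2 * m)"] central_Suc_even[of "2 * m"] by simp
  then show ?case
    using Suc.IH G2_step[of 0 "2 * m"] central_even[of "Suc m"] by (simp add: field_simps)
qed simp

lemma G1_at_minus_1: "G1 (Suc (2 * m)) (-1) = 1 - central (Suc (2 * m))"
  using G1_at_0[of "Suc m"] G1_Suc_0[of "Suc (2 * m)"] G_minus[of "Suc (2 * m)" 1] G0_Suc_0[of "Suc (2 * m)"] central_odd[of m]
    G_minus[of "Suc (2 * m)" 1]
  by simp

lemma G2_at_minus_1: "G2 (Suc (2 * m)) (-1) = (2 * real m + 3) * central (Suc (2 * m)) - 1"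
  using G2_Suc_0[of "Suc (2 * m)"] G_minus[of "Suc (2 * m)" 1] G2_at_0[of "Suc m"] G1_at_0[of "Suc m"] central_Suc_odd[of "Suc (2 * m)"]
  by (simp add: algebra_simps)

section \<open>Moments of the number of hits after the first wrong guess\<close>

lemma hits_at:
  assumes "length w = N" "excess w = (if even N then 0 else -1)"
  shows "real (hits w) = real (Suc N div 2) + real (returns w)"
  using assms by (auto simp: hits_eq_real elim!: oddE)

text \<open>
  At these two positions both possible next letters would be guessed correctly, whereas elsewhere
  exactly one would be.  So these are the restricted means by which the recursion of the moments
  differs from that of a binomial distribution with parameter \<open>1/2\<close>.
\<close>

definition center_mean :: "nat \<Rightarrow> (real \<Rightarrow> real) \<Rightarrow> real" where
  "center_mean N f = word_mean N (\<lambda>w. of_bool (excess w \<in> {0, -1}) * f (real (hits w)))"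

lemma center_mean_eq:
  "center_mean N f = local_mean N (if even N then 0 else -1) (\<lambda>r. f (real (Suc N div 2) + r))"
  unfolding center_mean_def local_mean_def
proof (rule word_mean_cong)
  fix w :: "bool list" assume w: "length w = N"
  then have "excess w \<in> {0, -1} \<longleftrightarrow> excess w = (if even N then 0 else -1)"
    using even_excess[of w] by auto
  then show "of_bool (excess w \<in> {0, -1}) * f (real (hits w)) =
      of_bool (excess w = (if even N then 0 else -1)) * f (real (Suc N div 2) + real (returns w))"
    using hits_at[OF w] by (cases "excess w = (if even N then 0 else -1)") auto
qed

lemma center_mean_0: "center_mean N (\<lambda>x. 1) = central N"
  using central_even[of "N div 2"] central_odd[of "N div 2"]
  by (auto simp: center_mean_eq G0_def)

lemma center_mean_G:
  fixes N :: nat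
  defines "s \<equiv> if even N then 0 else -1" and "h \<equiv> real (Suc N div 2)"
  shows "center_mean N (\<lambda>x. x) = h * G0 N s + (G1 N s - G0 N s) / 2"
    and "center_mean N (\<lambda>x. x * (x - 1)) =
      h * (h - 1) * G0 N s + h * (G1 N s - G0 N s) + (G2 N s - 2 * G1 N s + G0 N s) / 2"
proof -
  have "center_mean N (\<lambda>x. x) = local_mean N s (\<lambda>r. (h - 1/2) * 1 + 1/2 * (2 * r + 1))"
    unfolding center_mean_eq s_def h_def by (rule arg_cong[of _ _ "local_mean N _"]) (auto simp: field_simps)
  then show "center_mean N (\<lambda>x. x) = h * G0 N s + (G1 N s - G0 N s) / 2"
    unfolding local_mean_add[of _ _ "\<lambda>r. (h - 1/2) * 1"] local_mean_cmult G_defs[symmetric]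
    by (simp add: field_simps)
  have "center_mean N (\<lambda>x. x * (x - 1)) =
      local_mean N s (\<lambda>r. (h * (h - 1) - h + 1/2) * 1 +
        ((h - 1) * (2 * r + 1) + 1/2 * (2 * r ^ 2 + 2 * r + 1)))"
    unfolding center_mean_eq s_def h_def
    by (rule arg_cong[of _ _ "local_mean N _"]) (auto simp: field_simps power2_eq_square)
  then show "center_mean N (\<lambda>x. x * (x - 1)) =
      h * (h - 1) * G0 N s + h * (G1 N s - G0 N s) + (G2 N s - 2 * G1 N s + G0 N s) / 2"
    unfolding local_mean_add[of _ _ "\<lambda>r. (h * (h - 1) - h + 1/2) * 1"]
      local_mean_add[of _ _ "\<lambda>r. (h - 1) * (2 * r + 1)"] local_mean_cmult G_defs[symmetric]
    by (simp add: field_simps)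
qed

lemma G_center:
  "even N \<Longrightarrow> G0 N 0 = central N" "even N \<Longrightarrow> G1 N 0 = 1"
  "even N \<Longrightarrow> G2 N 0 = (real N + 1) * central N"
  "odd N \<Longrightarrow> G0 N (-1) = central N" "odd N \<Longrightarrow> G1 N (-1) = 1 - central N"
  "odd N \<Longrightarrow> G2 N (-1) = (real N + 2) * central N - 1"
  using central_even[of "N div 2"] central_odd[of "N div 2"] G1_at_0[of "N div 2"] G2_at_0[of "N div 2"]
    G1_at_minus_1[of "N div 2"] G2_at_minus_1[of "N div 2"]
  by (auto elim!: evenE oddE simp: algebra_simps)

lemma center_mean_1: "center_mean N (\<lambda>x. x) = 1/2 + central N * (real N - 1) / 2"
proof -
  have "real (Suc N div 2) = (if even N then real N / 2 else (real N + 1) / 2)"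
    by (auto elim!: evenE oddE)
  then show ?thesis
    by (auto simp: center_mean_G G_center) (auto simp: field_simps)
qed

lemma center_mean_2:
  "center_mean N (\<lambda>x. x * (x - 1)) =
     (real N - 2) / 2 + central N * ((real N)\<^sup>2 / 4 - real N / 2 + (if even N then 1 else 5/4))"
proof -
  have "real (Suc N div 2) = (if even N then real N / 2 else (real N + 1) / 2)"
    by (auto elim!: evenE oddE)
  then show ?thesis
    by (auto simp: center_mean_G G_center) (auto simp: field_simps power2_eq_square)
qed

text \<open>
  Falling factorials, for which \<open>falling_plus_1\<close> makes all recursions triangular in \<open>k\<close>.
\<close>

definition falling :: "nat \<Rightarrow> real \<Rightarrow> real" where "falling k x = (\<Prod>i<k. x - real i)"

lemma falling_simps: "falling 0 x = 1" "falling (Suc 0) x = x" "falling 1 x = x" "falling 2 x = x * (x - 1)" "falling 3 x = x * (x - 1) * (x - 2)"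
  by (simp_all add: falling_def numeral_2_eq_2 numeral_3_eq_3)

lemma falling_plus_1: "falling k (1 + x) = falling k x + real k * falling (k - 1) x"
proof (cases k)
  case (Suc j)
  have "falling (Suc j) (1 + x) = (x + 1) * falling j x"
    by (simp add: falling_def prod.lessThan_Suc_shift del: prod.lessThan_Suc)
  moreover have "falling (Suc j) x = falling j x * (x - real j)"
    by (simp add: falling_def)
  ultimately show ?thesis using Suc by (simp add: algebra_simps)
qed (simp add: falling_def)

definition hits_moment :: "nat \<Rightarrow> nat \<Rightarrow> real" where
  "hits_moment k N = word_mean N (\<lambda>w. falling k (real (hits w)))"

lemma hits_moment_Suc:
  "hits_moment k (Suc N) = hits_moment k N
     + real k / 2 * (hits_moment (k - 1) N + center_mean N (falling (k - 1)))"
proof -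
  have "hits_moment k (Suc N) = word_mean N (\<lambda>w. falling k (real (hits w)) +
      (real k / 2) * (falling (k - 1) (real (hits w)) +
          of_bool (excess w \<in> {0, -1}) * falling (k - 1) (real (hits w))))"
    unfolding hits_moment_def word_mean_Suc
    by (rule word_mean_cong) (auto simp: falling_plus_1 field_simps)
  then show ?thesis
    unfolding word_mean_add word_mean_cmult hits_moment_def center_mean_def .
qed

lemma hits_moment_0 [simp]: "hits_moment 0 N = 1"
  by (simp add: hits_moment_def falling_simps)

definition hits_coeff1 :: "nat \<Rightarrow> real" where
  "hits_coeff1 n = (if even n then real n + 1/2 else real n + 1)"
definition hits_coeff2 :: "nat \<Rightarrow> real" where
  "hits_coeff2 n =
     (if even n then (real n)\<^sup>2 - 3/2 * real n - 1 else (real n)\<^sup>2 - real n - 2)"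
definition hits_coeff3 :: "nat \<Rightarrow> real" where
  "hits_coeff3 n =
     (if even n then 3/4 * real n ^ 3 - 25/8 * (real n)\<^sup>2 + 4 * real n + 3
      else 3/4 * real n ^ 3 - 11/4 * (real n)\<^sup>2 + 9/4 * real n + 23/4)"

lemma hits_moment_1:
  "hits_moment 1 N = (real N - 1) / 2 + central N * hits_coeff1 N"
proof (induction N)
  case 0
  show ?case by (simp add: hits_moment_def falling_simps hits_coeff1_def)
next
  case (Suc N)
  have "hits_moment 1 (Suc N) = hits_moment 1 N + (1 + central N) / 2"
    using center_mean_0[of N] by (simp add: hits_moment_Suc falling_simps[abs_def])
  then show ?case unfolding Suc.IH hits_coeff1_def
    by (simp add: central_Suc_odd central_Suc_even) (auto simp: field_simps)
qed

lemma hits_moment_2: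
  "hits_moment 2 N = 1 - real N / 4 + (real N)\<^sup>2 / 4
     + central N * hits_coeff2 N"
proof (induction N)
  case 0
  show ?case by (simp add: hits_moment_def falling_simps hits_coeff2_def)
next
  case (Suc N)
  have "hits_moment 2 (Suc N) = hits_moment 2 N + (hits_moment 1 N + center_mean N (\<lambda>x. x))"
    by (simp add: hits_moment_Suc falling_simps[abs_def])
  then show ?case unfolding Suc.IH hits_coeff2_def hits_moment_1 hits_coeff1_def center_mean_1
    by (simp add: central_Suc_odd central_Suc_even) (auto simp: field_simps power2_eq_square)
qed

lemma hits_moment_3:
  "hits_moment 3 N = - 3 - real N / 8 + (real N) ^ 3 / 8
     + central N * hits_coeff3 N"
proof (induction N)
  case 0
  show ?case by (simp add: hits_moment_def falling_simps hits_coeff3_def)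
next
  case (Suc N)
  have "hits_moment 3 (Suc N) =
      hits_moment 3 N + 3/2 * (hits_moment 2 N + center_mean N (\<lambda>x. x * (x - 1)))"
    by (simp add: hits_moment_Suc falling_simps[abs_def])
  then show ?case unfolding Suc.IH hits_coeff3_def hits_moment_2 hits_coeff2_def center_mean_2
    by (simp add: central_Suc_odd central_Suc_even) (auto simp: field_simps power2_eq_square power3_eq_cube)
qed

section \<open>The score of a word\<close>

text \<open>
  If no top card follows the first \<open>False\<close>, the cut was made right here, the deck is in order and
  all guesses are correct.
\<close>

fun score :: "bool list \<Rightarrow> nat" where
  "score [] = 0"
| "score (b # w) = (if b then Suc (score w) else if True \<in> set w then hits w else Suc (length w))"

definition score_moment :: "nat \<Rightarrow> nat \<Rightarrow> real" where
  "score_moment k N = word_mean N (\<lambda>w. falling k (real (score w)))"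

lemma hits_replicate_False: "hits (replicate N False) = N"
proof -
  have "excess (replicate N False) = - int N" by (induction N) auto
  then show ?thesis by (induction N) auto
qed

lemma hits_no_True:
  assumes "True \<notin> set w" shows "hits w = length w"
proof -
  have "w = replicate (length w) False" using assms by (intro replicate_eqI) (metis (full_types))+
  then show ?thesis by (metis hits_replicate_False)
qed

text \<open>
  The last term is due to the word \<open>replicate (Suc N) False\<close>: it leaves the deck in order and scores
  \<open>Suc N\<close>, whereas a wrong first guess followed by \<open>replicate N False\<close> would score \<open>N\<close>.
\<close>

lemma score_moment_Suc:
  "score_moment k (Suc N) = (score_moment k N + real k * score_moment (k - 1) N + hits_moment k N) / 2
     + real k * falling (k - 1) (real N) / 2 ^ Suc N"
proof -
  have "falling k (real (score (False # w))) = falling k (real (hits w)) +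
      (if w = replicate N False then real k * falling (k - 1) (real N) else 0)" if "length w = N" for w
  proof (cases "True \<in> set w")
    case False
    then have "w = replicate N False" using that by (intro replicate_eqI) (metis (full_types))+
    then show ?thesis using False that by (simp add: hits_replicate_False falling_plus_1)
  qed auto
  then have "score_moment k (Suc N) = word_mean N (\<lambda>w. 1/2 * (falling k (real (score w)) +
      (real k * falling (k - 1) (real (score w)) + (falling k (real (hits w)) +
       (if w = replicate N False then real k * falling (k - 1) (real N) else 0)))))"
    unfolding score_moment_def word_mean_Suc
    by (intro word_mean_cong) (simp add: falling_plus_1)
  also have "\<dots> = 1/2 * (score_moment k N + (real k * score_moment (k - 1) N + (hits_moment k N +
       real k * falling (k - 1) (real N) / 2 ^ N)))"
    unfolding word_mean_cmult word_mean_add score_moment_def hits_moment_def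
    by (simp add: word_mean_delta)
  finally show ?thesis by (simp add: field_simps)
qed

lemma score_moment_0 [simp]: "score_moment 0 N = 1"
  by (simp add: score_moment_def falling_simps)

section \<open>Decks and words\<close>

lemma initial_run_eq:
  assumes "r = [] \<or> hd r \<noteq> Suc j"
  shows "initial_run ([1..<Suc j] @ r) = j"
proof -
  have *: "l \<le> j" if l: "l \<le> length ([1..<Suc j] @ r)" "take l ([1..<Suc j] @ r) = [1..<Suc l]" for l
  proof (rule ccontr)
    assume "\<not> l \<le> j"
    then have "j < l" "r \<noteq> []" using l(1) by (auto simp del: upt_Suc)
    then have "take l ([1..<Suc j] @ r) ! j = hd r" using l(1)
      by (simp add: nth_append hd_conv_nth del: upt_Suc)
    moreover have "[1..<Suc l] ! j = Suc j" using \<open>j < l\<close> by (simp del: upt_Suc)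
    ultimately have "hd r = Suc j" using l(2) by metis
    then show False using \<open>r \<noteq> []\<close> assms by blast
  qed
  show ?thesis
    unfolding initial_run_def
  proof (rule Max_eqI)
    show "finite {l. l \<le> length ([1..<Suc j] @ r) \<and> take l ([1..<Suc j] @ r) = [1..<Suc l]}"
      by (rule finite_subset[of _ "{..length ([1..<Suc j] @ r)}"]) blast+
    show "l \<le> j" if "l \<in> {l. l \<le> length ([1..<Suc j] @ r) \<and> take l ([1..<Suc j] @ r) = [1..<Suc l]}" for l
      using that * by blast
    show "j \<in> {l. l \<le> length ([1..<Suc j] @ r) \<and> take l ([1..<Suc j] @ r) = [1..<Suc l]}"
      by (simp del: upt_Suc)
  qed
qed

lemma optimal_guess_initial: "optimal_guess n [1..<Suc j] = Suc j"
proof -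
  have "initial_run [1..<Suc j] = j"
    using initial_run_eq[of "[]" j] unfolding append_Nil2 by blast
  then show ?thesis unfolding optimal_guess_def Let_def by (simp only: length_upt) simp
qed

lemma correct_guesses_identity: "correct_guesses (optimal_guess n) [1..<Suc n] = n"
proof -
  have "take i [1..<Suc n] = [1..<Suc i]" if "i < n" for i
    using that by (simp add: take_upt del: upt_Suc)
  then have "{i. i < length [1..<Suc n] \<and> optimal_guess n (take i [1..<Suc n]) = [1..<Suc n] ! i} = {..<n}"
    by (auto simp: optimal_guess_initial simp del: upt_Suc One_nat_def)
  then show ?thesis unfolding correct_guesses_def by simp
qed

lemma excess_eq: "excess w = int (length (filter id w)) - int (length (filter Not w))"
  by (induction w) auto

lemma card_less_Suc:
  "card {i. i < Suc n \<and> Q i} = of_bool (Q 0) + card {i. i < n \<and> Q (Suc i)}"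
proof -
  have "{i. i < Suc n \<and> Q i} = (if Q 0 then {0} else {}) \<union> Suc ` {i. i < n \<and> Q (Suc i)}"
    by (auto simp: image_iff less_Suc_eq_0_disj)
  then show ?thesis by (simp add: card_Un_disjoint card_image disjoint_iff)
qed

lemma hits_card: "hits w = card {i. i < length w \<and> (w ! i \<longleftrightarrow> excess (drop i w) \<ge> 0)}"
proof (induction w)
  case (Cons b w)
  then show ?case
    unfolding length_Cons card_less_Suc by simp
qed simp

lemma score_append: "score (replicate j True @ w) = j + score w"
  by (induction j) auto

lemma distinct_filterD:
  "distinct (filter P xs) \<Longrightarrow> distinct (filter (\<lambda>x. \<not> P x) xs) \<Longrightarrow> distinct xs"
  by (induction xs) (auto split: if_splits)

text \<open>
  With \<open>r\<close> the cards up to the first wrong guess and \<open>e\<close> the rest of the deck, this recovers the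
  remainder of a pile from the set of revealed cards.
\<close>

lemma filter_unrevealed:
  assumes "distinct e" "set r \<inter> set e = {}"
  shows "filter (\<lambda>c. c \<notin> set (r @ take k e)) (filter P e) = filter P (drop k e)"
proof -
  have "set (take k e) \<inter> set (drop k e) = {}"
    using assms(1) by (metis append_take_drop_id distinct_append)
  moreover have "set (take k e) \<subseteq> set e" "set (drop k e) \<subseteq> set e"
    by (auto dest: in_set_takeD in_set_dropD)
  ultimately have "filter (\<lambda>c. c \<notin> set (r @ take k e)) (take k e @ drop k e) = drop k e"
    using assms(2) unfolding filter_append
    by (subst filter_False, force, subst filter_True) auto
  then have "filter P (filter (\<lambda>c. c \<notin> set (r @ take k e)) e) = filter P (drop k e)"
    by simp
  then show ?thesis by (simp add: conj_commute)
qed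

text \<open>
  The first \<open>j\<close> guesses are correct and the next one is wrong.  From then on the guess is the top
  of a longest remaining pile, and hence correct if and only if the next card belongs to that pile.
\<close>

lemma correct_guesses_split:
  assumes "j < t"
    and top: "filter (\<lambda>c. c \<le> t) e = [Suc j..<Suc t]"
    and bottom: "filter (\<lambda>c. \<not> c \<le> t) e = [Suc (Suc t)..<Suc n]"
  shows "correct_guesses (optimal_guess n) ([1..<Suc j] @ Suc t # e) = j + hits (map (\<lambda>c. c \<le> t) e)"
proof -
  define d where "d = [1..<Suc j] @ Suc t # e"
  let ?P = "\<lambda>c. c \<le> t"
  have "distinct e" using distinct_filterD[of ?P e] top bottom by simp
  have "set e = set (filter ?P e) \<union> set (filter (\<lambda>c. \<not> ?P c) e)" by auto
  then have disj: "set ([1..<Suc j] @ [Suc t]) \<inter> set e = {}"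
    unfolding top bottom using \<open>j < t\<close> by auto
  have len: "length d = Suc j + length e" by (simp add: d_def)
  have hit: "optimal_guess n (take (Suc (j + k)) d) = d ! Suc (j + k) \<longleftrightarrow>
      (map ?P e ! k \<longleftrightarrow> excess (drop k (map ?P e)) \<ge> 0)" if "k < length e" for k
  proof -
    define as where "as = filter ?P (drop k e)"
    define bs where "bs = filter (\<lambda>c. \<not> ?P c) (drop k e)"
    have take: "take (Suc (j + k)) d = [1..<Suc j] @ Suc t # take k e"
      by (simp add: d_def del: upt_Suc)
    have run: "initial_run ([1..<Suc j] @ Suc t # take k e) = j"
      using \<open>j < t\<close> by (intro initial_run_eq) auto
    have as: "filter (\<lambda>c. c \<notin> set ([1..<Suc j] @ Suc t # take k e)) [Suc j..<Suc t] = as"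
      using filter_unrevealed[OF \<open>distinct e\<close> disj, of k ?P] unfolding as_def top by simp
    have bs: "filter (\<lambda>c. c \<notin> set ([1..<Suc j] @ Suc t # take k e)) [Suc (Suc t)..<Suc n] = bs"
      using filter_unrevealed[OF \<open>distinct e\<close> disj, of k "\<lambda>c. \<not> ?P c"] unfolding bs_def bottom by simp
    have guess: "optimal_guess n (take (Suc (j + k)) d) =
        (if length as \<ge> length bs then hd as else hd bs)"
      unfolding take optimal_guess_def run Let_def using as bs
      by (simp add: nth_append del: upt_Suc)
    have c: "drop k e = e ! k # drop (Suc k) e" using that by (simp add: Cons_nth_drop_Suc)
    have excess: "excess (drop k (map ?P e)) = int (length as) - int (length bs)"
      by (simp add: excess_eq as_def bs_def drop_map filter_map o_def)
    have dk: "d ! Suc (j + k) = e ! k" by (simp add: d_def nth_append del: upt_Suc)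
    have hd_P: "?P (hd as)" if "as \<noteq> []"
      using hd_in_set[OF that] by (auto simp: as_def)
    have hd_N: "\<not> ?P (hd bs)" if "bs \<noteq> []"
      using hd_in_set[OF that] by (auto simp: bs_def)
    show ?thesis
    proof (cases "?P (e ! k)")
      case True
      then have "as \<noteq> []" "hd as = e ! k" by (simp_all add: as_def c)
      then show ?thesis unfolding guess dk excess using True hd_N that by (cases "bs = []") auto
    next
      case False
      then have "bs \<noteq> []" "hd bs = e ! k" by (simp_all add: bs_def c)
      then show ?thesis unfolding guess dk excess using False hd_P that by (cases "as = []") auto
    qed
  qed
  have initial: "optimal_guess n (take i d) = Suc i" if "i \<le> j" for i
  proof -
    have "take i d = [1..<Suc i]" using that by (simp add: d_def take_upt del: upt_Suc)
    then show ?thesis by (simp only: optimal_guess_initial)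
  qed
  define B where "B = {k. k < length e \<and> (map ?P e ! k \<longleftrightarrow> excess (drop k (map ?P e)) \<ge> 0)}"
  have "{i. i < length d \<and> optimal_guess n (take i d) = d ! i} =
      {..<j} \<union> (\<lambda>k. Suc (j + k)) ` B"
    (is "?L = ?R")
  proof (rule set_eqI)
    fix i
    consider "i < j" | "i = j" | k where "i = Suc (j + k)"
      by (metis less_imp_Suc_add linorder_neqE_nat)
    then show "i \<in> ?L \<longleftrightarrow> i \<in> ?R"
    proof cases
      case 1
      then show ?thesis using initial[of i] by (auto simp: len d_def nth_append simp del: upt_Suc)
    next
      case 2
      then show ?thesis using initial[of i] \<open>j < t\<close> by (auto simp: len d_def nth_append simp del: upt_Suc)
    next
      case 3
      then show ?thesis using hit[of k] by (auto simp: len B_def)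
    qed
  qed
  moreover have "card ({..<j} \<union> (\<lambda>k. Suc (j + k)) ` B) = card {..<j} + card ((\<lambda>k. Suc (j + k)) ` B)"
    by (rule card_Un_disjoint) (auto simp: B_def)
  moreover have "card ((\<lambda>k. Suc (j + k)) ` B) = card B"
    by (rule card_image) (auto simp: inj_on_def)
  moreover have "card B = hits (map ?P e)"
    unfolding hits_card B_def by simp
  ultimately show ?thesis
    unfolding correct_guesses_def d_def[symmetric] by simp
qed

lemma correct_guesses_score:
  assumes "t \<le> n"
    and top: "filter (\<lambda>c. c \<le> t) d = [1..<Suc t]"
    and bottom: "filter (\<lambda>c. \<not> c \<le> t) d = [Suc t..<Suc n]"
  shows "correct_guesses (optimal_guess n) d = score (map (\<lambda>c. c \<le> t) d)"
proof -
  let ?P = "\<lambda>c. c \<le> t"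
  define r where "r = dropWhile ?P d"
  define j where "j = length (takeWhile ?P d)"
  have d: "d = takeWhile ?P d @ r" by (simp add: r_def)
  have "filter ?P d = takeWhile ?P d @ filter ?P r"
    by (subst (1) d) (auto simp: filter_id_conv dest: set_takeWhileD)
  then have split: "takeWhile ?P d @ filter ?P r = [1..<Suc t]" using top by simp
  have "takeWhile ?P d = take j [1..<Suc t]" "filter ?P r = drop j [1..<Suc t]"
    unfolding split[symmetric] by (simp_all add: j_def)
  moreover have "j \<le> t" using arg_cong[OF split, of length] by (simp add: j_def del: upt_Suc)
  ultimately have run: "takeWhile ?P d = [1..<Suc j]" and rtop: "filter ?P r = [Suc j..<Suc t]"
    by (simp_all add: take_upt drop_upt del: upt_Suc)
  have word: "map ?P d = replicate j True @ map ?P r"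
    by (subst d) (use \<open>j \<le> t\<close> in \<open>auto simp: run simp del: upt_Suc intro!: replicate_eqI\<close>)
  have rbottom: "filter (\<lambda>c. \<not> ?P c) r = [Suc t..<Suc n]"
  proof -
    have "filter (\<lambda>c. \<not> ?P c) (takeWhile ?P d) = []"
      by (auto simp: filter_empty_conv dest: set_takeWhileD)
    then have "filter (\<lambda>c. \<not> ?P c) d = filter (\<lambda>c. \<not> ?P c) r"
      by (subst d) simp
    then show ?thesis using bottom by simp
  qed
  show ?thesis
  proof (cases "j < t \<and> r \<noteq> []")
    case True
    then obtain c e where r: "r = c # e" by (cases r) auto
    have "\<not> ?P c" using hd_dropWhile[of ?P d] r by (auto simp: r_def[symmetric])
    then have "c # filter (\<lambda>c. \<not> ?P c) e = [Suc t..<Suc n]" and etop: "filter ?P e = [Suc j..<Suc t]"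
      using rbottom rtop by (simp_all add: r del: upt_Suc)
    then have "c # filter (\<lambda>c. \<not> ?P c) e = Suc t # [Suc (Suc t)..<Suc n]"
      by (cases "Suc t < Suc n") (simp_all add: upt_conv_Cons del: upt_Suc)
    then have c: "c = Suc t" and ebottom: "filter (\<lambda>c. \<not> ?P c) e = [Suc (Suc t)..<Suc n]"
      by blast+
    have "t \<in> set (filter ?P e)" unfolding etop using True by auto
    then have "True \<in> set (map ?P e)" by force
    moreover have "d = [1..<Suc j] @ Suc t # e" by (subst d) (simp add: run r c del: upt_Suc)
    ultimately show ?thesis
      using correct_guesses_split[OF _ etop ebottom] True unfolding word
      by (simp add: score_append r c del: upt_Suc)
  next
    case False
    have "j = t" using False \<open>j \<le> t\<close> rtop by (auto split: if_splits)
    have "filter (\<lambda>c. \<not> ?P c) r = r"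
      using rtop \<open>j = t\<close> by (auto simp: filter_id_conv filter_empty_conv simp del: upt_Suc)
    then have "r = [Suc t..<Suc n]" using rbottom by simp
    then have "d = [1..<Suc n]"
      using d run \<open>j = t\<close> upt_add_eq_append[of 1 "Suc t" "n - t"] \<open>t \<le> n\<close> by simp
    moreover have "map ?P r = replicate (n - t) False"
      unfolding \<open>r = [Suc t..<Suc n]\<close> by (auto intro!: replicate_eqI simp del: upt_Suc)
    moreover have "score (replicate k False) = k" for k
      by (cases k) (auto simp: hits_no_True)
    ultimately show ?thesis
      using word \<open>j = t\<close> \<open>t \<le> n\<close> correct_guesses_identity[of n] by (simp add: score_append del: upt_Suc)
  qed
qed

lemma merge_exists:
  assumes "length (filter id w) = length xs" "length (filter Not w) = length ys"
    "\<And>x. x \<in> set xs \<Longrightarrow> P x" "\<And>y. y \<in> set ys \<Longrightarrow> \<not> P y"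
  shows "\<exists>d. filter P d = xs \<and> filter (\<lambda>c. \<not> P c) d = ys \<and> map P d = w"
  using assms
proof (induction w arbitrary: xs ys)
  case (Cons b w)
  show ?case
  proof (cases b)
    case True
    then obtain x xs' where xs: "xs = x # xs'" using Cons.prems(1) by (cases xs) auto
    then obtain d where "filter P d = xs' \<and> filter (\<lambda>c. \<not> P c) d = ys \<and> map P d = w"
      using Cons.IH[of xs' ys] Cons.prems True by auto
    then show ?thesis using True xs Cons.prems(3) by (intro exI[of _ "x # d"]) auto
  next
    case False
    then obtain y ys' where ys: "ys = y # ys'" using Cons.prems(2) by (cases ys) auto
    then obtain d where "filter P d = xs \<and> filter (\<lambda>c. \<not> P c) d = ys' \<and> map P d = w"
      using Cons.IH[of xs ys'] Cons.prems False by auto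
    then show ?thesis using False ys Cons.prems(4) by (intro exI[of _ "y # d"]) auto
  qed
qed simp

lemma merge_unique:
  assumes "map P d = map P d'" "filter P d = filter P d'"
    "filter (\<lambda>c. \<not> P c) d = filter (\<lambda>c. \<not> P c) d'"
  shows "d = d'"
proof -
  have "length d = length d'" using assms(1) by (rule map_eq_imp_length_eq)
  then show ?thesis using assms by (induction rule: list_induct2) (auto split: if_splits)
qed

lemma shuffles_eq_filters:
  assumes "\<And>x. x \<in> set xs \<Longrightarrow> P x" "\<And>y. y \<in> set ys \<Longrightarrow> \<not> P y"
  shows "shuffles xs ys = {d. filter P d = xs \<and> filter (\<lambda>c. \<not> P c) d = ys}"
  using inv_image_partition[of xs P ys, OF assms] by (auto simp: vimage_def o_def)

text \<open>
  An interleaving of two known sequences is determined by its pattern, and every pattern with the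
  right number of letters occurs.
\<close>

lemma bij_betw_shuffles_words:
  assumes "\<And>x. x \<in> set xs \<Longrightarrow> P x" "\<And>y. y \<in> set ys \<Longrightarrow> \<not> P y"
  shows "bij_betw (map P) (shuffles xs ys)
           {w. length w = length xs + length ys \<and> length (filter id w) = length xs}"
proof -
  note sh = shuffles_eq_filters[of xs P ys, OF assms]
  have split: "length w = length (filter id w) + length (filter Not w)" for w :: "bool list"
    using sum_length_filter_compl[of id w] by (simp add: o_def id_def)
  show ?thesis
    unfolding bij_betw_def
  proof (intro conjI subset_antisym subsetI)
    show "inj_on (map P) (shuffles xs ys)"
      by (rule inj_onI) (auto simp: sh intro: merge_unique)
    show "w \<in> {w. length w = length xs + length ys \<and> length (filter id w) = length xs}"
      if w: "w \<in> map P ` shuffles xs ys" for w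
    proof -
      obtain d where "filter P d = xs" "filter (\<lambda>c. \<not> P c) d = ys" "w = map P d"
        using w by (auto simp: sh)
      then show ?thesis using sum_length_filter_compl[of P d] by (auto simp: filter_map o_def)
    qed
    show "w \<in> map P ` shuffles xs ys"
      if w: "w \<in> {w. length w = length xs + length ys \<and> length (filter id w) = length xs}" for w
    proof -
      have "\<exists>d. filter P d = xs \<and> filter (\<lambda>c. \<not> P c) d = ys \<and> map P d = w"
        using w split[of w] by (intro merge_exists) (auto simp: assms)
      then show ?thesis by (auto simp: sh)
    qed
  qed
qed

lemma expectation_riffle:
  "measure_pmf.expectation (riffle_shuffle n) (\<lambda>d. f (X n d)) = word_mean n (\<lambda>w. f (real (score w)))"
proof -
  let ?S = "\<lambda>t. shuffles [1..<Suc t] [Suc t..<Suc n]"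
  let ?W = "\<lambda>t. {w. length w = n \<and> length (filter id w) = t}"
  have sum: "(\<Sum>d\<in>?S t. f (X n d)) = (\<Sum>w\<in>?W t. f (real (score w)))" if "t \<le> n" for t
  proof -
    let ?P = "\<lambda>c. c \<le> t"
    have piles: "x \<le> t" if "x \<in> set [1..<Suc t]" for x using that by (simp del: upt_Suc)
    have piles': "\<not> y \<le> t" if "y \<in> set [Suc t..<Suc n]" for y using that by (simp del: upt_Suc)
    have length: "length [1..<Suc t] = t" "length [Suc t..<Suc n] = n - t" "t + (n - t) = n"
      using that by (simp_all del: upt_Suc)
    have bij: "bij_betw (map ?P) (?S t) (?W t)"
      using bij_betw_shuffles_words[of "[1..<Suc t]" ?P "[Suc t..<Suc n]", OF piles piles']
      unfolding length by blast
    have "(\<Sum>d\<in>?S t. f (X n d)) = (\<Sum>d\<in>?S t. f (real (score (map ?P d))))"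
    proof (rule sum.cong)
      fix d assume "d \<in> ?S t"
      then have "filter ?P d = [1..<Suc t]" "filter (\<lambda>c. \<not> ?P c) d = [Suc t..<Suc n]"
        using shuffles_eq_filters[of "[1..<Suc t]" ?P "[Suc t..<Suc n]", OF piles piles'] by blast+
      then show "f (X n d) = f (real (score (map ?P d)))"
        using correct_guesses_score[OF that] by (simp only: X_def)
    qed simp
    also have "\<dots> = (\<Sum>w\<in>?W t. f (real (score w)))"
      by (rule sum.reindex_bij_betw[OF bij])
    finally show ?thesis .
  qed
  have card: "card (?S t) = n choose t" if "t \<le> n" for t
    using card_disjoint_shuffles[of "[1..<Suc t]" "[Suc t..<Suc n]"] that by (auto simp del: upt_Suc)
  have nonempty: "?S t \<noteq> {}" if "t \<le> n" for t
  proof -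
    have "card (?S t) \<noteq> 0" using that by (simp only: card) simp
    then show ?thesis by (metis card.empty)
  qed
  have finite: "finite (set_pmf (pmf_of_set (?S t)))" if "t \<le> n" for t
    by (simp only: set_pmf_of_set[OF nonempty[OF that] finite_shuffles] finite_shuffles)
  have mean: "measure_pmf.expectation (pmf_of_set (?S t)) (\<lambda>d. f (X n d)) =
      (\<Sum>d\<in>?S t. f (X n d)) / real (n choose t)" if "t \<le> n" for t
    using integral_pmf_of_set[OF nonempty[OF that] finite_shuffles, of "\<lambda>d. f (X n d)"]
    by (simp only: card[OF that])
  have "measure_pmf.expectation (riffle_shuffle n) (\<lambda>d. f (X n d)) =
      (\<Sum>t\<le>n. pmf (binomial_pmf n (1/2)) t *
         measure_pmf.expectation (pmf_of_set (?S t)) (\<lambda>d. f (X n d)))"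
    unfolding riffle_shuffle_def
    by (subst pmf_expectation_bind[where A = "{..n}"])
       (auto simp: finite set_pmf_binomial simp del: upt_Suc One_nat_def)
  also have "\<dots> = (\<Sum>t\<le>n. (\<Sum>w\<in>?W t. f (real (score w))) / 2 ^ n)"
  proof (rule sum.cong)
    fix t assume "t \<in> {..n}"
    then have "t \<le> n" by simp
    then have "pmf (binomial_pmf n (1/2)) t = real (n choose t) / 2 ^ n"
      by (simp add: power_divide flip: power_add)
    then show "pmf (binomial_pmf n (1/2)) t * measure_pmf.expectation (pmf_of_set (?S t)) (\<lambda>d. f (X n d)) =
        (\<Sum>w\<in>?W t. f (real (score w))) / 2 ^ n"
      unfolding mean[OF \<open>t \<le> n\<close>] sum[OF \<open>t \<le> n\<close>] using \<open>t \<le> n\<close> by simp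
  qed simp
  also have "(\<Sum>t\<le>n. (\<Sum>w\<in>?W t. f (real (score w))) / 2 ^ n) =
      (\<Sum>t\<le>n. \<Sum>w\<in>?W t. f (real (score w))) / 2 ^ n"
    by (simp add: sum_divide_distrib)
  also have "(\<Sum>t\<le>n. \<Sum>w\<in>?W t. f (real (score w))) = (\<Sum>w | length w = n. f (real (score w)))"
    by (subst sum.UNION_disjoint[symmetric]) (auto intro!: sum.cong)
  finally show ?thesis by (simp add: word_mean_def)
qed

section \<open>Landau symbols along even and odd integers\<close>

lemma even_at_top_eq: "even_at_top = filtermap (\<lambda>m. 2 * m) sequentially"
proof (rule filter_eqI)
  fix P :: "nat \<Rightarrow> bool"
  have "(\<exists>N. \<forall>n\<ge>N. even n \<longrightarrow> P n) \<longleftrightarrow> (\<exists>N. \<forall>m\<ge>N. P (2 * m))"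
  proof safe
    fix N assume "\<forall>n\<ge>N. even n \<longrightarrow> P n"
    then show "\<exists>N. \<forall>m\<ge>N. P (2 * m)" by (intro exI[of _ N]) auto
  next
    fix N assume "\<forall>m\<ge>N. P (2 * m)"
    then show "\<exists>N. \<forall>n\<ge>N. even n \<longrightarrow> P n" by (intro exI[of _ "2 * N"]) (auto elim!: evenE)
  qed
  then show "eventually P even_at_top \<longleftrightarrow> eventually P (filtermap (\<lambda>m. 2 * m) sequentially)"
    by (simp add: even_at_top_def eventually_inf_principal eventually_filtermap eventually_sequentially)
qed

lemma odd_at_top_eq: "odd_at_top = filtermap (\<lambda>m. 2 * m + 1) sequentially"
proof (rule filter_eqI)
  fix P :: "nat \<Rightarrow> bool"
  have "(\<exists>N. \<forall>n\<ge>N. odd n \<longrightarrow> P n) \<longleftrightarrow> (\<exists>N. \<forall>m\<ge>N. P (2 * m + 1))"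
  proof safe
    fix N assume "\<forall>n\<ge>N. odd n \<longrightarrow> P n"
    then show "\<exists>N. \<forall>m\<ge>N. P (2 * m + 1)" by (intro exI[of _ N]) auto
  next
    fix N assume "\<forall>m\<ge>N. P (2 * m + 1)"
    then show "\<exists>N. \<forall>n\<ge>N. odd n \<longrightarrow> P n" by (intro exI[of _ "2 * N"]) (auto elim!: oddE)
  qed
  then show "eventually P odd_at_top \<longleftrightarrow> eventually P (filtermap (\<lambda>m. 2 * m + 1) sequentially)"
    by (simp add: odd_at_top_def eventually_inf_principal eventually_filtermap eventually_sequentially)
qed

lemma sup_even_odd_at_top: "sup even_at_top odd_at_top = sequentially"
proof (rule filter_eqI)
  fix P :: "nat \<Rightarrow> bool"
  have "eventually P sequentially" if "\<forall>\<^sub>F n in sequentially. even n \<longrightarrow> P n" "\<forall>\<^sub>F n in sequentially. odd n \<longrightarrow> P n"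
    using eventually_conj[OF that] by (rule eventually_mono) blast
  then show "eventually P (sup even_at_top odd_at_top) \<longleftrightarrow> eventually P sequentially"
    by (auto simp: even_at_top_def odd_at_top_def eventually_inf_principal eventually_sup elim: eventually_mono)
qed

lemma bigo_parity:
  fixes f g :: "nat \<Rightarrow> real"
  assumes "(\<lambda>m. f (2 * m)) \<in> O(\<lambda>m. g (2 * m))" "(\<lambda>m. f (2 * m + 1)) \<in> O(\<lambda>m. g (2 * m + 1))"
  shows "f \<in> O(g)"
proof -
  have "f \<in> O[even_at_top](g)" "f \<in> O[odd_at_top](g)"
    unfolding even_at_top_eq odd_at_top_eq landau_o.big.in_filtermap_iff using assms by auto
  then show ?thesis
    using landau_o.big.sup[of f even_at_top g odd_at_top] by (simp add: sup_even_odd_at_top)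
qed

text \<open>
  A bound \<open>K * g n\<close> for \<open>D n\<close> yields the bound \<open>(K / 2 + c) * g n\<close> for \<open>D (Suc n)\<close>.  The factor
  \<open>3/2\<close> lost in passing to \<open>g (Suc n)\<close> is less than \<open>2\<close>, and \<open>K \<ge> 6 * c\<close> closes the induction.
\<close>

lemma bigo_recursion_half:
  fixes D g r :: "nat \<Rightarrow> real"
  assumes rec: "\<And>n. D (Suc n) = D n / 2 + r n"
    and r: "r \<in> O(g)"
    and pos: "\<forall>\<^sub>F n in sequentially. g n > 0"
    and slow: "\<forall>\<^sub>F n in sequentially. g n \<le> 3/2 * g (Suc n)"
  shows "D \<in> O(g)"
proof -
  obtain c where c: "c > 0" "\<forall>\<^sub>F n in sequentially. norm (r n) \<le> c * norm (g n)"
    using r by (rule landau_o.bigE)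
  obtain N where N: "\<And>n. n \<ge> N \<Longrightarrow> \<bar>r n\<bar> \<le> c * g n \<and> g n > 0 \<and> g n \<le> 3/2 * g (Suc n)"
    using eventually_conj[OF c(2) eventually_conj[OF pos slow]]
    by (force simp: eventually_sequentially)
  define K where "K = max (6 * c) (\<bar>D N\<bar> / g N)"
  have "\<bar>D n\<bar> \<le> K * g n" if "n \<ge> N" for n
    using that
  proof (induction n rule: dec_induct)
    case base
    have "\<bar>D N\<bar> / g N \<le> K" by (simp add: K_def)
    then show ?case using N[of N] by (simp add: field_simps)
  next
    case (step n)
    have "\<bar>D (Suc n)\<bar> \<le> \<bar>D n\<bar> / 2 + \<bar>r n\<bar>" unfolding rec by linarith
    also have "\<dots> \<le> K * g n / 2 + c * g n" using step.IH N[OF step.hyps(1)] by linarith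
    also have "\<dots> = (K / 2 + c) * g n" by (simp add: algebra_simps)
    also have "\<dots> \<le> (K / 2 + K / 6) * g n"
    proof -
      have "6 * c \<le> K" by (simp add: K_def)
      then show ?thesis using N[OF step.hyps(1)] by (intro mult_right_mono) auto
    qed
    also have "\<dots> = 2/3 * K * g n" by (simp add: algebra_simps)
    also have "\<dots> \<le> 2/3 * K * (3/2 * g (Suc n))"
      using N[OF step.hyps(1)] c(1) by (intro mult_left_mono) (auto simp: K_def max_def)
    finally show ?case by simp
  qed
  then show ?thesis
    using N by (intro bigoI[of _ K] eventually_sequentiallyI[of N]) force
qed

text \<open>
  As \<open>1 / m ^ 6\<close> is at most \<open>1 / m ^ 5 - 1 / (m + 1) ^ 5\<close> for large \<open>m\<close>, adding and subtracting a
  multiple of \<open>1 / m ^ 5\<close> makes \<open>\<delta>\<close> monotone with limit \<open>0\<close>, which fixes the signs.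
\<close>

lemma bigo_telescope:
  fixes \<delta> :: "nat \<Rightarrow> real"
  assumes lim: "\<delta> \<longlonglongrightarrow> 0" and diff: "(\<lambda>m. \<delta> (Suc m) - \<delta> m) \<in> O(\<lambda>m. 1 / real m ^ 6)"
  shows "\<delta> \<in> O(\<lambda>m. 1 / real m ^ 5)"
proof -
  obtain c where c: "c > 0" "\<forall>\<^sub>F m in sequentially. norm (\<delta> (Suc m) - \<delta> m) \<le> c * norm (1 / real m ^ 6)"
    using diff by (rule landau_o.bigE)
  have "\<forall>\<^sub>F m in sequentially. 1 / real m ^ 6 \<le> 1 / real m ^ 5 - 1 / real (Suc m) ^ 5"
    unfolding of_nat_Suc by real_asymp
  from eventually_conj[OF c(2) this] obtain M where M: "\<forall>m\<ge>M. norm (\<delta> (Suc m) - \<delta> m) \<le> c * norm (1 / real m ^ 6) \<and>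
      1 / real m ^ 6 \<le> 1 / real m ^ 5 - 1 / real (Suc m) ^ 5"
    unfolding eventually_sequentially by blast
  have step: "\<bar>\<delta> (Suc m) - \<delta> m\<bar> \<le> c / real m ^ 5 - c / real (Suc m) ^ 5" if "m \<ge> M" for m
  proof -
    have "\<bar>\<delta> (Suc m) - \<delta> m\<bar> \<le> c * (1 / real m ^ 6)" using M that by simp
    also have "\<dots> \<le> c * (1 / real m ^ 5 - 1 / real (Suc m) ^ 5)"
      using M that c(1) by (intro mult_left_mono) auto
    finally show ?thesis by (simp add: algebra_simps)
  qed
  have inv: "(\<lambda>m. c / real (m + M) ^ 5) \<longlonglongrightarrow> 0"
  proof -
    have "(\<lambda>m. c / real m ^ 5) \<longlonglongrightarrow> 0" by real_asymp
    then show ?thesis by (rule LIMSEQ_ignore_initial_segment)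
  qed
  have lim': "(\<lambda>m. \<delta> (m + M)) \<longlonglongrightarrow> 0" using lim by (rule LIMSEQ_ignore_initial_segment)
  have "incseq (\<lambda>m. \<delta> (m + M) - c / real (m + M) ^ 5)"
  proof (rule incseq_SucI)
    show "\<delta> (n + M) - c / real (n + M) ^ 5 \<le> \<delta> (Suc n + M) - c / real (Suc n + M) ^ 5" for n
      using step[of "n + M"] by (simp add: abs_le_iff)
  qed
  moreover have "(\<lambda>m. \<delta> (m + M) - c / real (m + M) ^ 5) \<longlonglongrightarrow> 0"
    using tendsto_diff[OF lim' inv] by simp
  ultimately have upper: "\<delta> (m + M) - c / real (m + M) ^ 5 \<le> 0" for m by (rule incseq_le)
  have "decseq (\<lambda>m. \<delta> (m + M) + c / real (m + M) ^ 5)"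
  proof (rule decseq_SucI)
    show "\<delta> (Suc n + M) + c / real (Suc n + M) ^ 5 \<le> \<delta> (n + M) + c / real (n + M) ^ 5" for n
      using step[of "n + M"] by (simp add: abs_le_iff)
  qed
  moreover have "(\<lambda>m. \<delta> (m + M) + c / real (m + M) ^ 5) \<longlonglongrightarrow> 0"
    using tendsto_add[OF lim' inv] by simp
  ultimately have lower: "0 \<le> \<delta> (m + M) + c / real (m + M) ^ 5" for m by (rule decseq_ge)
  have "\<bar>\<delta> m\<bar> \<le> c * \<bar>1 / real m ^ 5\<bar>" if "m \<ge> M" for m
    using upper[of "m - M"] lower[of "m - M"] that by (simp add: abs_le_iff)
  then show ?thesis by (intro bigoI[of _ c] eventually_sequentiallyI[of M]) simp
qed

lemma bigo_exp_minus_1: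
  fixes \<delta> :: "nat \<Rightarrow> real"
  assumes "\<delta> \<longlonglongrightarrow> 0"
  shows "(\<lambda>m. exp (\<delta> m) - 1) \<in> O(\<delta>)"
proof -
  have bound: "\<bar>exp x - 1\<bar> \<le> 2 * \<bar>x\<bar>" if "\<bar>x\<bar> < 1/2" for x :: real
  proof -
    have "x \<le> exp x - 1" using exp_ge_add_one_self[of x] by linarith
    have "exp x * (1 - x) \<le> exp x * exp (- x)"
      using exp_ge_add_one_self[of "- x"] by (intro mult_left_mono) auto
    then have "exp x * (1 - x) \<le> 1" by (simp add: exp_minus)
    then have "exp x - 1 \<le> x * exp x" by (simp add: algebra_simps)
    also have "\<dots> \<le> \<bar>x\<bar> * 2"
      using exp_bound_half[of x] that by (intro mult_mono) auto
    finally show ?thesis using \<open>x \<le> exp x - 1\<close> by linarith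
  qed
  have "\<forall>\<^sub>F m in sequentially. \<bar>\<delta> m\<bar> < 1/2"
    using order_tendstoD(2)[OF tendsto_rabs[OF assms], of "1/2"] by simp
  then show ?thesis
    by (intro bigoI[of _ 2]) (auto elim!: eventually_mono intro: bound)
qed

section \<open>Expansion of the central binomial probability\<close>

definition stirling_ratio :: "nat \<Rightarrow> real" where
  "stirling_ratio n = central n * sqrt (pi * real n / 2)"

lemma stirling_ratio_power2: "(stirling_ratio n)\<^sup>2 = (central n)\<^sup>2 * (pi * real n / 2)"
  by (simp add: stirling_ratio_def power_mult_distrib)

lemma central_step_even:
  "central (2 * Suc m) = central (2 * m) * ((2 * real m + 1) / (2 * real m + 2))"
  using central_Suc_odd[of "Suc (2 * m)"] central_Suc_even[of "2 * m"] by simp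

lemma central_step_odd:
  "central (2 * Suc m + 1) = central (2 * m + 1) * ((2 * real m + 3) / (2 * real m + 4))"
  using central_Suc_odd[of "Suc (2 * m)"] central_Suc_even[of "Suc (Suc (2 * m))"]
  by (simp add: add.commute)

lemma wallis_central: "(\<Prod>k = 1..m. 4 * real k ^ 2 / (4 * real k ^ 2 - 1)) = 1 / ((central (2 * m))\<^sup>2 * (2 * real m + 1))"
proof (induction m)
  case (Suc m)
  have *: "1 / (c\<^sup>2 * a) * (b\<^sup>2 / (a * a')) = 1 / ((c * (a / b))\<^sup>2 * a')"
    if "a \<noteq> 0" "b \<noteq> 0" "a' \<noteq> 0" "c \<noteq> 0" for a b c a' :: real
    using that by (simp add: field_simps power2_eq_square)
  have "4 * real (Suc m) ^ 2 - 1 = (2 * real m + 1) * (2 * real m + 3)"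
    "4 * real (Suc m) ^ 2 = (2 * real m + 2) ^ 2" "2 * real (Suc m) + 1 = 2 * real m + 3"
    by (simp_all add: power2_eq_square algebra_simps)
  moreover have "1 / ((central (2 * m))\<^sup>2 * (2 * real m + 1)) *
        ((2 * real m + 2)\<^sup>2 / ((2 * real m + 1) * (2 * real m + 3))) =
      1 / ((central (2 * m) * ((2 * real m + 1) / (2 * real m + 2)))\<^sup>2 * (2 * real m + 3))"
    using central_pos[of "2 * m"] by (intro *) auto
  moreover have "(\<Prod>k = 1..Suc m. 4 * real k ^ 2 / (4 * real k ^ 2 - 1)) =
      (\<Prod>k = 1..m. 4 * real k ^ 2 / (4 * real k ^ 2 - 1)) * (4 * real (Suc m) ^ 2 / (4 * real (Suc m) ^ 2 - 1))"
    by simp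
  ultimately show ?case unfolding Suc.IH central_step_even by (simp only:)
qed simp

lemma stirling_ratio_even_lim: "(\<lambda>m. (stirling_ratio (2 * m))\<^sup>2) \<longlonglongrightarrow> 1"
proof -
  have "(\<lambda>m. inverse (1 / ((central (2 * m))\<^sup>2 * (2 * real m + 1)))) \<longlonglongrightarrow> inverse (pi / 2)"
    using wallis unfolding wallis_central by (rule tendsto_inverse) simp
  moreover have "(\<lambda>m. pi * real m / (2 * real m + 1)) \<longlonglongrightarrow> pi / 2"
    by real_asymp
  ultimately have "(\<lambda>m. inverse (1 / ((central (2 * m))\<^sup>2 * (2 * real m + 1))) * (pi * real m / (2 * real m + 1)))
      \<longlonglongrightarrow> inverse (pi / 2) * (pi / 2)"
    by (rule tendsto_mult)
  moreover have "inverse (1 / ((central (2 * m))\<^sup>2 * (2 * real m + 1))) * (pi * real m / (2 * real m + 1)) =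
      (stirling_ratio (2 * m))\<^sup>2" for m
    using of_nat_0_le_iff[of m, where ?'a = real]
    by (simp add: stirling_ratio_def power_mult_distrib add_nonneg_eq_0_iff)
  ultimately show ?thesis by simp
qed

lemma stirling_ratio_odd_lim: "(\<lambda>m. (stirling_ratio (2 * m + 1))\<^sup>2) \<longlonglongrightarrow> 1"
proof -
  have "(\<lambda>m. ((2 * real m + 1) / (2 * real m + 2))\<^sup>2 * ((2 * real m + 1) / (2 * real m))) \<longlonglongrightarrow> 1"
    by real_asymp
  from tendsto_mult[OF stirling_ratio_even_lim this]
  have "(\<lambda>m. (stirling_ratio (2 * m))\<^sup>2 * (((2 * real m + 1) / (2 * real m + 2))\<^sup>2 * ((2 * real m + 1) / (2 * real m)))) \<longlonglongrightarrow> 1"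
    by simp
  moreover have "\<forall>\<^sub>F m in sequentially. (stirling_ratio (2 * m))\<^sup>2 * (((2 * real m + 1) / (2 * real m + 2))\<^sup>2 * ((2 * real m + 1) / (2 * real m))) =
      (stirling_ratio (2 * m + 1))\<^sup>2"
    using eventually_gt_at_top[of 0]
  proof eventually_elim
    case (elim m)
    have "(c * (a / b))\<^sup>2 * (pi * a / 2) = c\<^sup>2 * (pi * M / 2) * ((a / b)\<^sup>2 * (a / M))"
      if "M \<noteq> 0" "b \<noteq> 0" for a b c M :: real
      using that by (simp add: field_simps)
    from this[of "2 * real m" "2 * real m + 2" "central (2 * m)" "2 * real m + 1"] elim
    show ?case
      using central_Suc_even[of "2 * m"] by (simp add: stirling_ratio_power2 add.commute)
  qed
  ultimately show ?thesis by (rule Lim_transform_eventually)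
qed

text \<open>
  These truncated series are determined by the ratio of consecutive values of \<open>stirling_ratio\<close>
  along even and along odd arguments: their logarithms have the same increments up to
  order \<open>1 / n ^ 6\<close>.
\<close>

definition stirling_even :: "real \<Rightarrow> real" where
  "stirling_even x = 1 - 1/4/x + 1/32/x^2 + 5/128/x^3 - 21/2048/x^4"
definition stirling_odd :: "real \<Rightarrow> real" where
  "stirling_odd x = 1 - 3/4/x + 25/32/x^2 - 105/128/x^3 + 1659/2048/x^4"

text \<open>
  If \<open>T\<close> has nearly the same logarithmic increments \<open>ln (q m) / 2\<close> as \<open>stirling_ratio\<close> along \<open>\<phi>\<close>, and
  both tend to \<open>1\<close>, then the sum of the defects bounds the logarithm of their quotient.
\<close>

lemma stirling_transfer:
  fixes \<phi> :: "nat \<Rightarrow> nat" and T q :: "nat \<Rightarrow> real"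
  assumes lim: "(\<lambda>m. (stirling_ratio (\<phi> m))\<^sup>2) \<longlonglongrightarrow> 1"
    and T: "T \<longlonglongrightarrow> 1"
    and q: "\<forall>\<^sub>F m in sequentially. \<phi> m > 0 \<and> (stirling_ratio (\<phi> (Suc m)))\<^sup>2 = (stirling_ratio (\<phi> m))\<^sup>2 * q m"
    and qT: "(\<lambda>m. ln (q m) / 2 - (ln (T (Suc m)) - ln (T m))) \<in> O(\<lambda>m. 1 / real m ^ 6)"
  shows "(\<lambda>m. stirling_ratio (\<phi> m) - T m) \<in> O(\<lambda>m. 1 / real m ^ 5)"
proof -
  define \<delta> where "\<delta> m = ln ((stirling_ratio (\<phi> m))\<^sup>2) / 2 - ln (T m)" for m
  have "\<delta> \<longlonglongrightarrow> ln 1 / 2 - ln 1"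
    unfolding \<delta>_def using lim T by (intro tendsto_intros) auto
  then have \<delta>0: "\<delta> \<longlonglongrightarrow> 0" by simp
  have pos: "stirling_ratio n > 0" if "n > 0" for n
    using that central_pos[of n] by (simp add: stirling_ratio_def)
  have eq: "\<forall>\<^sub>F m in sequentially. ln (q m) / 2 - (ln (T (Suc m)) - ln (T m)) = \<delta> (Suc m) - \<delta> m"
    using q eventually_sequentially_Suc[THEN iffD2, OF q]
  proof eventually_elim
    case (elim m)
    let ?h = "(stirling_ratio (\<phi> m))\<^sup>2"
    have h: "?h > 0" using pos[of "\<phi> m"] elim by simp
    moreover have "?h * q m > 0"
      using pos[of "\<phi> (Suc m)"] elim by (metis zero_less_power)
    ultimately have "q m > 0" by (simp add: zero_less_mult_iff)
    have "ln (?h * q m) = ln ?h + ln (q m)"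
      using h \<open>q m > 0\<close> by (rule ln_mult_pos)
    then show ?case using elim by (simp add: \<delta>_def add_divide_distrib)
  qed
  have "(\<lambda>m. \<delta> (Suc m) - \<delta> m) \<in> O(\<lambda>m. 1 / real m ^ 6)"
    using qT unfolding landau_o.big.in_cong[OF eq] .
  then have \<delta>: "\<delta> \<in> O(\<lambda>m. 1 / real m ^ 5)" using bigo_telescope[OF \<delta>0] by simp
  have "T \<in> O(\<lambda>_. 1)" using T by (intro bigoI_tendsto[of _ _ 1]) auto
  then have "(\<lambda>m. T m * (exp (\<delta> m) - 1)) \<in> O(\<lambda>m. 1 * (1 / real m ^ 5))"
    using landau_o.big_trans[OF bigo_exp_minus_1[OF \<delta>0] \<delta>] by (rule landau_o.big.mult)
  moreover have "\<forall>\<^sub>F m in sequentially. T m * (exp (\<delta> m) - 1) = stirling_ratio (\<phi> m) - T m"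
    using q order_tendstoD(1)[OF T, of 0, simplified]
  proof eventually_elim
    case (elim m)
    have "exp (ln ((stirling_ratio (\<phi> m))\<^sup>2) / 2) = stirling_ratio (\<phi> m)"
      using pos[of "\<phi> m"] elim by (simp add: ln_realpow)
    then have "exp (\<delta> m) = stirling_ratio (\<phi> m) / T m"
      using elim by (simp add: \<delta>_def exp_diff)
    then show ?case using elim by (simp add: field_simps)
  qed
  ultimately show ?thesis by (simp add: landau_o.big.in_cong)
qed

lemma stirling_ratio_step_even:
  assumes "m > 0"
  shows "(stirling_ratio (2 * Suc m))\<^sup>2 = (stirling_ratio (2 * m))\<^sup>2 *
           ((2 * real m + 1)\<^sup>2 / (2 * real m * (2 * real m + 2)))"
proof -
  have *: "(c * (a / b))\<^sup>2 * (pi * b / 2) = c\<^sup>2 * (pi * M / 2) * (a\<^sup>2 / (M * b))"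
    if "M \<noteq> 0" "b \<noteq> 0" for a b c M :: real
    using that by (simp add: field_simps power2_eq_square)
  have "(central (2 * m) * ((2 * real m + 1) / (2 * real m + 2)))\<^sup>2 * (pi * (2 * real m + 2) / 2) =
      (central (2 * m))\<^sup>2 * (pi * (2 * real m) / 2) * ((2 * real m + 1)\<^sup>2 / (2 * real m * (2 * real m + 2)))"
    by (rule *) (use assms in simp_all)
  moreover have "real (2 * Suc m) = 2 * real m + 2" "real (2 * m) = 2 * real m" by simp_all
  ultimately show ?thesis
    unfolding stirling_ratio_power2 central_step_even by (simp only:)
qed

lemma stirling_ratio_step_odd:
  "(stirling_ratio (2 * Suc m + 1))\<^sup>2 = (stirling_ratio (2 * m + 1))\<^sup>2 *
           ((2 * real m + 3) ^ 3 / ((2 * real m + 1) * (2 * real m + 4)\<^sup>2))"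
proof -
  have *: "(c * (a / b))\<^sup>2 * (pi * a / 2) = c\<^sup>2 * (pi * M / 2) * (a ^ 3 / (M * b\<^sup>2))"
    if "M \<noteq> 0" "b \<noteq> 0" for a b c M :: real
    using that by (simp add: field_simps power2_eq_square power3_eq_cube)
  have "(central (2 * m + 1) * ((2 * real m + 3) / (2 * real m + 4)))\<^sup>2 * (pi * (2 * real m + 3) / 2) =
      (central (2 * m + 1))\<^sup>2 * (pi * (2 * real m + 1) / 2) *
        ((2 * real m + 3) ^ 3 / ((2 * real m + 1) * (2 * real m + 4)\<^sup>2))"
    by (rule *) simp_all
  moreover have "real (2 * Suc m + 1) = 2 * real m + 3" "real (2 * m + 1) = 2 * real m + 1"
    by simp_all
  ultimately show ?thesis
    unfolding stirling_ratio_power2 central_step_odd by (simp only:)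
qed

lemma stirling_even_expansion:
  "(\<lambda>m. stirling_ratio (2 * m) - stirling_even (real (2 * m))) \<in> O(\<lambda>m. 1 / real m ^ 5)"
proof (rule stirling_transfer[OF stirling_ratio_even_lim])
  show "(\<lambda>m. stirling_even (real (2 * m))) \<longlonglongrightarrow> 1"
    unfolding stirling_even_def of_nat_mult by real_asymp
  show "\<forall>\<^sub>F m in sequentially. 2 * m > 0 \<and> (stirling_ratio (2 * Suc m))\<^sup>2 = (stirling_ratio (2 * m))\<^sup>2 *
           ((2 * real m + 1)\<^sup>2 / (2 * real m * (2 * real m + 2)))"
    using eventually_gt_at_top[of 0] by eventually_elim (use stirling_ratio_step_even in auto)
  show "(\<lambda>m. ln ((2 * real m + 1)\<^sup>2 / (2 * real m * (2 * real m + 2))) / 2 -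
      (ln (stirling_even (real (2 * Suc m))) - ln (stirling_even (real (2 * m))))) \<in> O(\<lambda>m. 1 / real m ^ 6)"
    unfolding stirling_even_def of_nat_mult of_nat_Suc by real_asymp
qed

lemma stirling_odd_expansion:
  "(\<lambda>m. stirling_ratio (2 * m + 1) - stirling_odd (real (2 * m + 1))) \<in> O(\<lambda>m. 1 / real m ^ 5)"
proof (rule stirling_transfer[OF stirling_ratio_odd_lim])
  show "(\<lambda>m. stirling_odd (real (2 * m + 1))) \<longlonglongrightarrow> 1"
    unfolding stirling_odd_def of_nat_mult of_nat_add by real_asymp
  show "\<forall>\<^sub>F m in sequentially. 2 * m + 1 > 0 \<and> (stirling_ratio (2 * Suc m + 1))\<^sup>2 = (stirling_ratio (2 * m + 1))\<^sup>2 *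
           ((2 * real m + 3) ^ 3 / ((2 * real m + 1) * (2 * real m + 4)\<^sup>2))"
    using stirling_ratio_step_odd by auto
  show "(\<lambda>m. ln ((2 * real m + 3) ^ 3 / ((2 * real m + 1) * (2 * real m + 4)\<^sup>2)) / 2 -
      (ln (stirling_odd (real (2 * Suc m + 1))) - ln (stirling_odd (real (2 * m + 1))))) \<in> O(\<lambda>m. 1 / real m ^ 6)"
    unfolding stirling_odd_def of_nat_mult of_nat_Suc of_nat_add by real_asymp
qed

lemma central_bigo: "central \<in> O(\<lambda>n. 1 / sqrt (real n))"
proof -
  have ratio: "stirling_ratio \<in> O(\<lambda>_. 1)"
  proof (rule bigo_parity)
    have "(\<lambda>m. stirling_ratio (2 * m) - stirling_even (real (2 * m))) \<in> O(\<lambda>_. 1)"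
      using stirling_even_expansion by (rule landau_o.big_trans) real_asymp
    moreover have "(\<lambda>m. stirling_even (real (2 * m))) \<in> O(\<lambda>_. 1)"
      unfolding stirling_even_def of_nat_mult by real_asymp
    ultimately have "(\<lambda>m. stirling_ratio (2 * m) - stirling_even (real (2 * m)) + stirling_even (real (2 * m))) \<in> O(\<lambda>_. 1)"
      by (rule sum_in_bigo)
    then show "(\<lambda>m. stirling_ratio (2 * m)) \<in> O(\<lambda>m. 1)" by simp
    have "(\<lambda>m. stirling_ratio (2 * m + 1) - stirling_odd (real (2 * m + 1))) \<in> O(\<lambda>_. 1)"
      using stirling_odd_expansion by (rule landau_o.big_trans) real_asymp
    moreover have "(\<lambda>m. stirling_odd (real (2 * m + 1))) \<in> O(\<lambda>_. 1)"
      unfolding stirling_odd_def of_nat_mult of_nat_add by real_asymp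
    ultimately have "(\<lambda>m. stirling_ratio (2 * m + 1) - stirling_odd (real (2 * m + 1)) + stirling_odd (real (2 * m + 1))) \<in> O(\<lambda>_. 1)"
      by (rule sum_in_bigo)
    then show "(\<lambda>m. stirling_ratio (2 * m + 1)) \<in> O(\<lambda>m. 1)" by simp
  qed
  have "(\<lambda>n. 1 / sqrt (pi * real n / 2)) \<in> O(\<lambda>n. 1 / sqrt (real n))" by real_asymp
  from landau_o.big.mult[OF ratio this]
  have "(\<lambda>n. stirling_ratio n * (1 / sqrt (pi * real n / 2))) \<in> O(\<lambda>n. 1 / sqrt (real n))" by simp
  moreover have "\<forall>\<^sub>F n in sequentially. stirling_ratio n * (1 / sqrt (pi * real n / 2)) = central n"
    using eventually_gt_at_top[of 0] by eventually_elim (simp add: stirling_ratio_def)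
  ultimately show ?thesis by (simp add: landau_o.big.in_cong)
qed

section \<open>The score moments up to small errors\<close>

text \<open>
  Inserting \<open>central n\<close> times a Laurent series into the recursion of the score moments determines
  all coefficients of that series, the two parities being coupled.  The series are cut off where
  the residual of the recursion falls below the accuracy that is claimed.
\<close>

definition score_coeff1 :: "nat \<Rightarrow> real" where
  "score_coeff1 n = (let x = real n in if even n then x - 1/2 - 2/3/x - 4/3/x^2 else x - 4/3/x - 4/3/x^2)"
definition score_coeff2 :: "nat \<Rightarrow> real" where
  "score_coeff2 n = (let x = real n in if even n then x^2 - 5/2*x - 2/3 - 16/9/x - 64/9/x^2
     else x^2 - 2*x - 7/3 - 8/9/x - 8/x^2)"
definition score_coeff3 :: "nat \<Rightarrow> real" where
  "score_coeff3 n = (let x = real n in if even n then 3/4*x^3 - 31/8*x^2 + 5*x - 2/3 - 52/9/x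
     else 3/4*x^3 - 7/2*x^2 + 11/4*x + 11/3 - 80/9/x)"

definition central_step :: "nat \<Rightarrow> real" where
  "central_step n = (if even n then (real n + 1) / (real n + 2) else 1)"

lemma central_Suc: "central (Suc n) = central n * central_step n"
  by (simp add: central_step_def central_Suc_even central_Suc_odd)

lemma residual_bigo:
  "(\<lambda>n. (score_coeff1 n + hits_coeff1 n) / 2 - central_step n * score_coeff1 (Suc n)) \<in> O(\<lambda>n. 1 / real n ^ 3)"
  "(\<lambda>n. (score_coeff2 n + 2 * score_coeff1 n + hits_coeff2 n) / 2 - central_step n * score_coeff2 (Suc n)) \<in> O(\<lambda>n. 1 / real n ^ 3)"
  "(\<lambda>n. (score_coeff3 n + 3 * score_coeff2 n + hits_coeff3 n) / 2 - central_step n * score_coeff3 (Suc n)) \<in> O(\<lambda>n. 1 / real n ^ 2)"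
  by (rule bigo_parity; simp add: score_coeff1_def score_coeff2_def score_coeff3_def hits_coeff1_def hits_coeff2_def hits_coeff3_def central_step_def Let_def; real_asymp)+

text \<open>
  The polynomial parts satisfy the recursion exactly, together with the polynomial parts of the
  hits moments.
\<close>

definition score_error :: "nat \<Rightarrow> nat \<Rightarrow> real" where
  "score_error k n = score_moment k n - [1,
     (real n - 1) / 2 + central n * score_coeff1 n,
     (real n)\<^sup>2 / 4 - real n / 4 + central n * score_coeff2 n,
     real n ^ 3 / 8 - 13 * real n / 8 + central n * score_coeff3 n] ! k"

lemma score_error_Suc:
  "score_error 1 (Suc n) = score_error 1 n / 2 +
     (central n * ((score_coeff1 n + hits_coeff1 n) / 2 - central_step n * score_coeff1 (Suc n)) + 1 / 2 ^ Suc n)"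
  "score_error 2 (Suc n) = score_error 2 n / 2 + (score_error 1 n +
     (central n * ((score_coeff2 n + 2 * score_coeff1 n + hits_coeff2 n) / 2 - central_step n * score_coeff2 (Suc n)) + 2 * real n / 2 ^ Suc n))"
  "score_error 3 (Suc n) = score_error 3 n / 2 + (3/2 * score_error 2 n +
     (central n * ((score_coeff3 n + 3 * score_coeff2 n + hits_coeff3 n) / 2 - central_step n * score_coeff3 (Suc n)) +
       3 * real n * (real n - 1) / 2 ^ Suc n))"
  unfolding score_error_def score_moment_Suc hits_moment_1 hits_moment_2 hits_moment_3 central_Suc
  by (simp_all add: numeral_2_eq_2 numeral_3_eq_3 hits_moment_1[unfolded One_nat_def]
     hits_moment_2[unfolded numeral_2_eq_2] hits_moment_3[unfolded numeral_3_eq_3]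
     falling_simps[unfolded numeral_2_eq_2])
   (simp_all add: field_simps power2_eq_square power3_eq_cube eval_nat_numeral)

lemma score_error_bigo:
  "score_error 1 \<in> O(\<lambda>n. 1 / (sqrt (real n) * real n ^ 3))"
  "score_error 2 \<in> O(\<lambda>n. 1 / (sqrt (real n) * real n ^ 3))"
  "score_error 3 \<in> O(\<lambda>n. 1 / (sqrt (real n) * real n ^ 2))"
proof -
  let ?g = "\<lambda>n. 1 / (sqrt (real n) * real n ^ 3)" and ?g' = "\<lambda>n. 1 / (sqrt (real n) * real n ^ 2)"
  have pos: "\<forall>\<^sub>F n in sequentially. ?g n > 0" "\<forall>\<^sub>F n in sequentially. ?g' n > 0"
    by real_asymp+
  have slow: "\<forall>\<^sub>F n in sequentially. ?g n \<le> 3/2 * ?g (Suc n)"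
    "\<forall>\<^sub>F n in sequentially. ?g' n \<le> 3/2 * ?g' (Suc n)"
    unfolding of_nat_Suc by real_asymp+
  have small: "(\<lambda>n. 1 / 2 ^ Suc n) \<in> O(?g)" "(\<lambda>n. 2 * real n / 2 ^ Suc n) \<in> O(?g)"
    "(\<lambda>n. 3 * real n * (real n - 1) / 2 ^ Suc n) \<in> O(?g')"
    unfolding power_Suc by real_asymp+
  have main: "(\<lambda>n. central n * ((score_coeff1 n + hits_coeff1 n) / 2 - central_step n * score_coeff1 (Suc n))) \<in> O(?g)"
    "(\<lambda>n. central n * ((score_coeff2 n + 2 * score_coeff1 n + hits_coeff2 n) / 2 - central_step n * score_coeff2 (Suc n))) \<in> O(?g)"
    "(\<lambda>n. central n * ((score_coeff3 n + 3 * score_coeff2 n + hits_coeff3 n) / 2 - central_step n * score_coeff3 (Suc n))) \<in> O(?g')"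
    using residual_bigo[THEN landau_o.big.mult[OF central_bigo]] by simp_all
  show 1: "score_error 1 \<in> O(?g)"
    by (rule bigo_recursion_half[OF score_error_Suc(1) sum_in_bigo(1)[OF main(1) small(1)] pos(1) slow(1)])
  show 2: "score_error 2 \<in> O(?g)"
    by (rule bigo_recursion_half[OF score_error_Suc(2)
          sum_in_bigo(1)[OF 1 sum_in_bigo(1)[OF main(2) small(2)]] pos(1) slow(1)])
  have "?g \<in> O(?g')" by real_asymp
  with 2 have "(\<lambda>n. 3/2 * score_error 2 n) \<in> O(?g')" using landau_o.big_trans by simp
  then show "score_error 3 \<in> O(?g')"
    by (rule bigo_recursion_half[OF score_error_Suc(3)
          sum_in_bigo(1)[OF _ sum_in_bigo(1)[OF main(3) small(3)]] pos(2) slow(2)])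
qed

section \<open>The expansions\<close>

text \<open>
  With \<open>S = sqrt (2 * n / pi)\<close> one has \<open>central n = S * stirling_ratio n / n\<close>.  Since \<open>Rk n / n\<close> grows like
  \<open>n ^ (5 - p)\<close>, replacing \<open>stirling_ratio\<close> by its expansion \<open>T\<close>, which is accurate to \<open>1 / n ^ 5\<close>, costs
  \<open>1 / n ^ p\<close> inside the bracket; the error \<open>D\<close> is a factor \<open>S\<close> larger than that.
\<close>

lemma expansion_transfer:
  fixes E D P Rk :: "nat \<Rightarrow> real" and Q T :: "real \<Rightarrow> real" and F :: "nat filter"
  assumes E: "\<And>n. E n = P n + central n * Rk n + D n"
    and T: "(\<lambda>m. stirling_ratio (\<phi> m) - T (real (\<phi> m))) \<in> O(\<lambda>m. 1 / real m ^ 5)"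
    and \<phi>: "\<And>m. m > 0 \<Longrightarrow> \<phi> m > 0" "filterlim \<phi> at_top sequentially"
       "(\<lambda>m. 1 / real m) \<in> O(\<lambda>m. 1 / real (\<phi> m))"
    and Q: "(\<lambda>m. T (real (\<phi> m)) * Rk (\<phi> m) / real (\<phi> m) - Q (real (\<phi> m))) \<in> O(\<lambda>m. 1 / real m ^ p)"
    and R: "(\<lambda>m. Rk (\<phi> m) / real (\<phi> m)) \<in> O(\<lambda>m. real m ^ (5 - p))" and p: "p \<le> 5"
    and D: "D \<in> O(\<lambda>n. 1 / (sqrt (real n) * real n ^ (p - 1)))" "p > 0"
    and F: "F = filtermap \<phi> sequentially"
  shows "\<exists>R \<in> O[F](\<lambda>n. 1 / real n ^ p). \<forall>\<^sub>F n in F. E n = P n + sqrt (2 * real n / pi) * (Q (real n) + R n)"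
proof (intro bexI)
  let ?S = "\<lambda>n. sqrt (2 * real n / pi)"
  define R where "R n = stirling_ratio n * Rk n / real n - Q (real n) + D n / ?S n" for n
  have "central n = ?S n * (stirling_ratio n / real n)" if "n > 0" for n
  proof -
    have "?S n * sqrt (pi * real n / 2) = real n"
      by (simp add: real_sqrt_mult[symmetric] power2_eq_square[symmetric])
    then show ?thesis using that by (simp add: stirling_ratio_def algebra_simps)
  qed
  note central_eq = this
  have eq: "E n = P n + ?S n * (Q (real n) + R n)" if "n > 0" for n
  proof -
    have *: "s * (q + (h * r / x - q + d / s)) = s * (h / x) * r + d" if "s \<noteq> 0" for s q h r x d :: real
      using that by (simp add: distrib_left right_diff_distrib)
    have "?S n \<noteq> 0" using that by simp
    then show ?thesis unfolding R_def by (subst *) (simp_all only: E central_eq[OF that, symmetric] add.assoc not_False_eq_True)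
  qed
  show "\<forall>\<^sub>F n in F. E n = P n + ?S n * (Q (real n) + R n)"
    unfolding F eventually_filtermap using eventually_gt_at_top[of 0]
    by eventually_elim (intro eq \<phi>(1))
  have inv: "(\<lambda>m. 1 / real m ^ p) \<in> O(\<lambda>m. 1 / real (\<phi> m) ^ p)"
    using landau_o.big_power[OF \<phi>(3), of p] by (simp add: power_divide)
  have "(\<lambda>m. (stirling_ratio (\<phi> m) - T (real (\<phi> m))) * (Rk (\<phi> m) / real (\<phi> m))) \<in>
      O(\<lambda>m. 1 / real m ^ 5 * real m ^ (5 - p))"
    by (rule landau_o.big.mult[OF T R])
  also have "(\<lambda>m. 1 / real m ^ 5 * real m ^ (5 - p)) \<in> O(\<lambda>m. 1 / real m ^ p)"
  proof (intro bigoI[of _ 1] eventually_sequentiallyI[of 1])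
    fix m :: nat assume "m \<ge> 1"
    then show "norm (1 / real m ^ 5 * real m ^ (5 - p)) \<le> 1 * norm (1 / real m ^ p)"
      using p by (simp add: power_diff)
  qed
  finally have 1: "(\<lambda>m. (stirling_ratio (\<phi> m) - T (real (\<phi> m))) * (Rk (\<phi> m) / real (\<phi> m))) \<in> O(\<lambda>m. 1 / real m ^ p)" .
  have "(\<lambda>m. stirling_ratio (\<phi> m) * Rk (\<phi> m) / real (\<phi> m) - Q (real (\<phi> m))) \<in> O(\<lambda>m. 1 / real m ^ p)"
    using sum_in_bigo(1)[OF 1 Q] by (simp add: algebra_simps diff_divide_distrib)
  then have 2: "(\<lambda>m. stirling_ratio (\<phi> m) * Rk (\<phi> m) / real (\<phi> m) - Q (real (\<phi> m))) \<in> O(\<lambda>m. 1 / real (\<phi> m) ^ p)"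
    using inv by (rule landau_o.big_trans)
  have "(\<lambda>n. 1 / ?S n) \<in> O(\<lambda>n. 1 / sqrt (real n))" by real_asymp
  with D(1) have "(\<lambda>n. D n * (1 / ?S n)) \<in> O(\<lambda>n. 1 / (sqrt (real n) * real n ^ (p - 1)) * (1 / sqrt (real n)))"
    by (rule landau_o.big.mult)
  also have "(\<lambda>n. 1 / (sqrt (real n) * real n ^ (p - 1)) * (1 / sqrt (real n))) = (\<lambda>n. 1 / real n ^ p)"
    using \<open>p > 0\<close> by (auto simp: fun_eq_iff power_eq_if)
  finally have 3: "(\<lambda>m. D (\<phi> m) / ?S (\<phi> m)) \<in> O(\<lambda>m. 1 / real (\<phi> m) ^ p)"
    using landau_o.big.compose[OF _ \<phi>(2)] by fastforce
  show "R \<in> O[F](\<lambda>n. 1 / real n ^ p)"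
    unfolding F landau_o.big.in_filtermap_iff R_def by (rule sum_in_bigo(1)[OF 2 3])
qed

lemma sqrt_powr:
  fixes x :: real assumes "x > 0"
  shows "sqrt (2 / pi) * x powr (3/2) = sqrt (2 * x / pi) * x"
    "sqrt (2 / pi) * x powr (5/2) = sqrt (2 * x / pi) * x\<^sup>2"
proof -
  have "x powr (3/2) = sqrt x * x" "x powr (5/2) = sqrt x * x\<^sup>2"
    using assms powr_add[of x "1/2" 1] powr_add[of x "1/2" 2]
    by (simp_all add: powr_half_sqrt powr_numeral)
  then show "sqrt (2 / pi) * x powr (3/2) = sqrt (2 * x / pi) * x"
    "sqrt (2 / pi) * x powr (5/2) = sqrt (2 * x / pi) * x\<^sup>2"
    by (simp_all add: real_sqrt_mult real_sqrt_divide)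
qed

theorem mainTheorem2:
  fixes E2 E3 :: "nat \<Rightarrow> real"
  defines "E2 \<equiv> \<lambda>n. measure_pmf.expectation (riffle_shuffle n) (\<lambda>d. X n d * (X n d - 1))"
    and "E3 \<equiv> \<lambda>n. measure_pmf.expectation (riffle_shuffle n)
                      (\<lambda>d. X n d * (X n d - 1) * (X n d - 2))"
  shows
    "(\<exists>R \<in> O[odd_at_top](\<lambda>n. 1 / real n ^ 4). \<forall>\<^sub>F n in odd_at_top.
        E2 n = real n ^ 2 / 4 + sqrt (2 / pi) * real n powr (3/2) - real n / 4
          - sqrt (2 * real n / pi) *
            (11/4 + 5 / (96 * real n) + 1753 / (1152 * real n ^ 2) + 13733 / (2048 * real n ^ 3)
             + R n)) \<and>
     (\<exists>R \<in> O[odd_at_top](\<lambda>n. 1 / real n ^ 3). \<forall>\<^sub>F n in odd_at_top.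
        E3 n = real n ^ 3 / 8 + 3/4 * sqrt (2 / pi) * real n powr (5/2)
          - 65/16 * sqrt (2 / pi) * real n powr (3/2) - 13 * real n / 8
          + sqrt (2 * real n / pi) *
            (763/128 - 2681 / (1536 * real n) - 443239 / (73728 * real n ^ 2) + R n)) \<and>
     (\<exists>R \<in> O[even_at_top](\<lambda>n. 1 / real n ^ 4). \<forall>\<^sub>F n in even_at_top.
        E2 n = real n ^ 2 / 4 + sqrt (2 / pi) * real n powr (3/2) - real n / 4
          - sqrt (2 * real n / pi) *
            (11/4 + 1 / (96 * real n) + 1901 / (1152 * real n ^ 2) + 13917 / (2048 * real n ^ 3)
             + R n)) \<and>
     (\<exists>R \<in> O[even_at_top](\<lambda>n. 1 / real n ^ 3). \<forall>\<^sub>F n in even_at_top.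
        E3 n = real n ^ 3 / 8 + 3/4 * sqrt (2 / pi) * real n powr (5/2)
          - 65/16 * sqrt (2 / pi) * real n powr (3/2) - 13 * real n / 8
          + sqrt (2 * real n / pi) *
            (767/128 - 3085 / (1536 * real n) - 413903 / (73728 * real n ^ 2) + R n))"
proof -
  have E2: "E2 n = ((real n)\<^sup>2 / 4 - real n / 4) + central n * score_coeff2 n + score_error 2 n" for n
    using expectation_riffle[of n "falling 2"]
    by (simp add: E2_def score_error_def score_moment_def falling_simps)
  have E3: "E3 n = (real n ^ 3 / 8 - 13 * real n / 8) + central n * score_coeff3 n + score_error 3 n" for n
    using expectation_riffle[of n "falling 3"]
    by (simp add: E3_def score_error_def score_moment_def falling_simps)
  have odd_pos: "eventually (\<lambda>n. n > 0) odd_at_top" and even_pos: "eventually (\<lambda>n. n > 0) even_at_top"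
    by (simp_all add: odd_at_top_def even_at_top_def eventually_inf_principal eventually_mono[OF eventually_gt_at_top[of 0]])
  have phi_odd: "2 * m + 1 > 0" "filterlim (\<lambda>m. 2 * m + 1) at_top sequentially"
    "(\<lambda>m. 1 / real m) \<in> O(\<lambda>m. 1 / real (2 * m + 1))" for m :: nat
  proof -
    show "filterlim (\<lambda>m::nat. 2 * m + 1) at_top sequentially"
      by (rule filterlim_subseq) (auto simp: strict_mono_def)
    show "(\<lambda>m. 1 / real m) \<in> O(\<lambda>m. 1 / real (2 * m + 1))"
      unfolding of_nat_add of_nat_mult by real_asymp
  qed simp
  have phi_even: "m > 0 \<Longrightarrow> 2 * m > 0" "filterlim (\<lambda>m. 2 * m) at_top sequentially"
    "(\<lambda>m. 1 / real m) \<in> O(\<lambda>m. 1 / real (2 * m))" for m :: nat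
  proof -
    show "filterlim (\<lambda>m::nat. 2 * m) at_top sequentially"
      by (rule filterlim_subseq) (auto simp: strict_mono_def)
    show "(\<lambda>m. 1 / real m) \<in> O(\<lambda>m. 1 / real (2 * m))"
      unfolding of_nat_add of_nat_mult by real_asymp
  qed simp
  have "\<exists>R \<in> O[odd_at_top](\<lambda>n. 1 / real n ^ 4). \<forall>\<^sub>F n in odd_at_top.
      E2 n = ((real n)\<^sup>2 / 4 - real n / 4) + sqrt (2 * real n / pi) *
       ((\<lambda>x. x - (11/4 + 5 / (96 * x) + 1753 / (1152 * x ^ 2) + 13733 / (2048 * x ^ 3))) (real n) + R n)"
  proof (rule expansion_transfer[OF E2 stirling_odd_expansion phi_odd])
    show "(\<lambda>m. stirling_odd (real (2 * m + 1)) * score_coeff2 (2 * m + 1) / real (2 * m + 1) -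
        (\<lambda>x. x - (11/4 + 5 / (96 * x) + 1753 / (1152 * x ^ 2) + 13733 / (2048 * x ^ 3))) (real (2 * m + 1)))
      \<in> O(\<lambda>m. 1 / real m ^ 4)"
      by (simp add: score_coeff2_def stirling_odd_def Let_def) real_asymp
    show "(\<lambda>m. score_coeff2 (2 * m + 1) / real (2 * m + 1)) \<in> O(\<lambda>m. real m ^ (5 - 4))"
      by (simp add: score_coeff2_def Let_def) real_asymp
  qed (use score_error_bigo(2) odd_at_top_eq in simp_all)
  then obtain Ra where Ra: "Ra \<in> O[odd_at_top](\<lambda>n. 1 / real n ^ 4)" "\<forall>\<^sub>F n in odd_at_top.
      E2 n = ((real n)\<^sup>2 / 4 - real n / 4) + sqrt (2 * real n / pi) *
       (real n - (11/4 + 5 / (96 * real n) + 1753 / (1152 * real n ^ 2) + 13733 / (2048 * real n ^ 3)) + Ra n)"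
    by blast
  have "\<exists>R \<in> O[even_at_top](\<lambda>n. 1 / real n ^ 4). \<forall>\<^sub>F n in even_at_top.
      E2 n = ((real n)\<^sup>2 / 4 - real n / 4) + sqrt (2 * real n / pi) *
       ((\<lambda>x. x - (11/4 + 1 / (96 * x) + 1901 / (1152 * x ^ 2) + 13917 / (2048 * x ^ 3))) (real n) + R n)"
  proof (rule expansion_transfer[OF E2 stirling_even_expansion phi_even])
    show "(\<lambda>m. stirling_even (real (2 * m)) * score_coeff2 (2 * m) / real (2 * m) -
        (\<lambda>x. x - (11/4 + 1 / (96 * x) + 1901 / (1152 * x ^ 2) + 13917 / (2048 * x ^ 3))) (real (2 * m)))
      \<in> O(\<lambda>m. 1 / real m ^ 4)"
      by (simp add: score_coeff2_def stirling_even_def Let_def) real_asymp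
    show "(\<lambda>m. score_coeff2 (2 * m) / real (2 * m)) \<in> O(\<lambda>m. real m ^ (5 - 4))"
      by (simp add: score_coeff2_def Let_def) real_asymp
  qed (use score_error_bigo(2) even_at_top_eq in simp_all)
  then obtain Rb where Rb: "Rb \<in> O[even_at_top](\<lambda>n. 1 / real n ^ 4)" "\<forall>\<^sub>F n in even_at_top.
      E2 n = ((real n)\<^sup>2 / 4 - real n / 4) + sqrt (2 * real n / pi) *
       (real n - (11/4 + 1 / (96 * real n) + 1901 / (1152 * real n ^ 2) + 13917 / (2048 * real n ^ 3)) + Rb n)"
    by blast
  have "\<exists>R \<in> O[odd_at_top](\<lambda>n. 1 / real n ^ 3). \<forall>\<^sub>F n in odd_at_top.
      E3 n = (real n ^ 3 / 8 - 13 * real n / 8) + sqrt (2 * real n / pi) *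
       ((\<lambda>x. 3/4 * x\<^sup>2 - 65/16 * x + (763/128 - 2681 / (1536 * x) - 443239 / (73728 * x ^ 2))) (real n) + R n)"
  proof (rule expansion_transfer[OF E3 stirling_odd_expansion phi_odd])
    show "(\<lambda>m. stirling_odd (real (2 * m + 1)) * score_coeff3 (2 * m + 1) / real (2 * m + 1) -
        (\<lambda>x. 3/4 * x\<^sup>2 - 65/16 * x + (763/128 - 2681 / (1536 * x) - 443239 / (73728 * x ^ 2))) (real (2 * m + 1)))
      \<in> O(\<lambda>m. 1 / real m ^ 3)"
      by (simp add: score_coeff3_def stirling_odd_def Let_def) real_asymp
    show "(\<lambda>m. score_coeff3 (2 * m + 1) / real (2 * m + 1)) \<in> O(\<lambda>m. real m ^ (5 - 3))"
      by (simp add: score_coeff3_def Let_def) real_asymp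
  qed (use score_error_bigo(3) odd_at_top_eq in simp_all)
  then obtain Rc where Rc: "Rc \<in> O[odd_at_top](\<lambda>n. 1 / real n ^ 3)" "\<forall>\<^sub>F n in odd_at_top.
      E3 n = (real n ^ 3 / 8 - 13 * real n / 8) + sqrt (2 * real n / pi) *
       (3/4 * (real n)\<^sup>2 - 65/16 * real n + (763/128 - 2681 / (1536 * real n) - 443239 / (73728 * real n ^ 2)) + Rc n)"
    by blast
  have "\<exists>R \<in> O[even_at_top](\<lambda>n. 1 / real n ^ 3). \<forall>\<^sub>F n in even_at_top.
      E3 n = (real n ^ 3 / 8 - 13 * real n / 8) + sqrt (2 * real n / pi) *
       ((\<lambda>x. 3/4 * x\<^sup>2 - 65/16 * x + (767/128 - 3085 / (1536 * x) - 413903 / (73728 * x ^ 2))) (real n) + R n)"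
  proof (rule expansion_transfer[OF E3 stirling_even_expansion phi_even])
    show "(\<lambda>m. stirling_even (real (2 * m)) * score_coeff3 (2 * m) / real (2 * m) -
        (\<lambda>x. 3/4 * x\<^sup>2 - 65/16 * x + (767/128 - 3085 / (1536 * x) - 413903 / (73728 * x ^ 2))) (real (2 * m)))
      \<in> O(\<lambda>m. 1 / real m ^ 3)"
      by (simp add: score_coeff3_def stirling_even_def Let_def) real_asymp
    show "(\<lambda>m. score_coeff3 (2 * m) / real (2 * m)) \<in> O(\<lambda>m. real m ^ (5 - 3))"
      by (simp add: score_coeff3_def Let_def) real_asymp
  qed (use score_error_bigo(3) even_at_top_eq in simp_all)
  then obtain Rd where Rd: "Rd \<in> O[even_at_top](\<lambda>n. 1 / real n ^ 3)" "\<forall>\<^sub>F n in even_at_top.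
      E3 n = (real n ^ 3 / 8 - 13 * real n / 8) + sqrt (2 * real n / pi) *
       (3/4 * (real n)\<^sup>2 - 65/16 * real n + (767/128 - 3085 / (1536 * real n) - 413903 / (73728 * real n ^ 2)) + Rd n)"
    by blast
  have shape2: "A + sqrt (2 / pi) * x powr (3/2) - B - sqrt (2 * x / pi) * (L + - r) =
      (A - B) + sqrt (2 * x / pi) * (x - L + r)" if "x > 0" for A B L r x :: real
    by (simp only: sqrt_powr[OF that]) (simp add: algebra_simps)
  have shape3: "A + 3/4 * sqrt (2 / pi) * x powr (5/2) - 65/16 * sqrt (2 / pi) * x powr (3/2) - B
        + sqrt (2 * x / pi) * (L + r) =
      (A - B) + sqrt (2 * x / pi) * (3/4 * x\<^sup>2 - 65/16 * x + L + r)" if "x > 0" for A B L r x :: real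
    by (simp only: mult.assoc sqrt_powr[OF that]) (simp add: algebra_simps)
  show ?thesis
  proof (intro conjI)
    show "\<exists>R \<in> O[odd_at_top](\<lambda>n. 1 / real n ^ 4). \<forall>\<^sub>F n in odd_at_top.
        E2 n = real n ^ 2 / 4 + sqrt (2 / pi) * real n powr (3/2) - real n / 4
          - sqrt (2 * real n / pi) *
            (11/4 + 5 / (96 * real n) + 1753 / (1152 * real n ^ 2) + 13733 / (2048 * real n ^ 3)
             + R n)"
    proof (rule bexI[of _ "\<lambda>n. - Ra n"])
      show "\<forall>\<^sub>F n in odd_at_top.
        E2 n = real n ^ 2 / 4 + sqrt (2 / pi) * real n powr (3/2) - real n / 4
          - sqrt (2 * real n / pi) *
            (11/4 + 5 / (96 * real n) + 1753 / (1152 * real n ^ 2) + 13733 / (2048 * real n ^ 3)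
             + - Ra n)"
        using Ra(2) odd_pos by eventually_elim (simp only: shape2 of_nat_0_less_iff)
    qed (use Ra(1) in simp)
    show "\<exists>R \<in> O[even_at_top](\<lambda>n. 1 / real n ^ 4). \<forall>\<^sub>F n in even_at_top.
        E2 n = real n ^ 2 / 4 + sqrt (2 / pi) * real n powr (3/2) - real n / 4
          - sqrt (2 * real n / pi) *
            (11/4 + 1 / (96 * real n) + 1901 / (1152 * real n ^ 2) + 13917 / (2048 * real n ^ 3)
             + R n)"
    proof (rule bexI[of _ "\<lambda>n. - Rb n"])
      show "\<forall>\<^sub>F n in even_at_top.
        E2 n = real n ^ 2 / 4 + sqrt (2 / pi) * real n powr (3/2) - real n / 4
          - sqrt (2 * real n / pi) *
            (11/4 + 1 / (96 * real n) + 1901 / (1152 * real n ^ 2) + 13917 / (2048 * real n ^ 3)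
             + - Rb n)"
        using Rb(2) even_pos by eventually_elim (simp only: shape2 of_nat_0_less_iff)
    qed (use Rb(1) in simp)
    show "\<exists>R \<in> O[odd_at_top](\<lambda>n. 1 / real n ^ 3). \<forall>\<^sub>F n in odd_at_top.
        E3 n = real n ^ 3 / 8 + 3/4 * sqrt (2 / pi) * real n powr (5/2)
          - 65/16 * sqrt (2 / pi) * real n powr (3/2) - 13 * real n / 8
          + sqrt (2 * real n / pi) *
            (763/128 - 2681 / (1536 * real n) - 443239 / (73728 * real n ^ 2) + R n)"
      using Rc(2) odd_pos by (intro bexI[OF _ Rc(1)], eventually_elim) (simp only: shape3 of_nat_0_less_iff)
    show "\<exists>R \<in> O[even_at_top](\<lambda>n. 1 / real n ^ 3). \<forall>\<^sub>F n in even_at_top.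
        E3 n = real n ^ 3 / 8 + 3/4 * sqrt (2 / pi) * real n powr (5/2)
          - 65/16 * sqrt (2 / pi) * real n powr (3/2) - 13 * real n / 8
          + sqrt (2 * real n / pi) *
            (767/128 - 3085 / (1536 * real n) - 413903 / (73728 * real n ^ 2) + R n)"
      using Rd(2) even_pos by (intro bexI[OF _ Rd(1)], eventually_elim) (simp only: shape3 of_nat_0_less_iff)
  qed
qed

end
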